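(* Let $K$ be the closed disk in $\mathbb{R}^2$ centered at the origin with radius $3$. There exists a computable $C^\infty$ function $h:\mathbb{R}^2\to\mathbb{R}^2$ with $h\in\mathcal{V}(K)$ such that the system $dx/dt=h(x)$ has a unique equilibrium point $s$, which is computable and is a sink, and the basin of attraction $W_s$ of $s$ is non-computable. Moreover, for any $C$-neighborhood $U$ of $h$ in $\mathcal{V}(K)$ there exists a computable $C^\infty$ function $\hat h\in U$ such that $dx/dt=\hat h(x)$ has a unique equilibrium point $\hat s$, which is computable and is a sink, and the basin of attraction $W_{\hat s}$ of $\hat s$ is non-computable.
   Context: $\mathcal{V}(K)$ is the set of $C^1$ vector fields $K\to\mathbb{R}^2$ pointing inwards along the boundary of $K$. A $C$-neighborhood is a neighborhood in the topology of the norm $\|f\|=\max_{x\in K}\|f(x)\|$ (with $\|(y_1,y_2)\|=\max|y_i|$). An equilibrium $s$ of $dx/dt=h(x)$ (i.e. $h(s)=0$) is a sink if a neighborhood of $s$ is contained in its basin of attraction, the set of initial points whose trajectories converge to $s$ as $t\to\infty$. A point is computable if a Turing machine produces rational approximations within $2^{-k}$; a function $\mathbb{R}^2\to\mathbb{R}^2$ is computable if a Turing machine produces rational-coefficient polynomials $P_{k,l}$ within $2^{-k}$ of it on $\overline{B}(0,2^l)$; an open set is computable if there are a computable sequence of rational balls with union the set and a computable sequence dense in its complement. *)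

theory Defs
  imports "HOL-Analysis.Analysis" "HOL-Library.Nat_Bijection"
begin

section \<open>Turing machines\<close>

text \<open>
  Deterministic multi-tape machines. Symbols and states are natural numbers, of which a finite
  transition table mentions only finitely many; 0 is the blank and the initial state is 0.
  A tape \<open>(ls, rs)\<close> is infinite in both directions: \<open>ls\<close> lists the cells left of the head, nearest
  first, \<open>rs\<close> lists the scanned cell and the cells to its right; all cells beyond the lists are
  blank. The machine halts when no table entry matches.
\<close>

datatype dir = Go_Left | Stay | Go_Right

type_synonym tape = "nat list \<times> nat list"
type_synonym tm = "((nat \<times> nat list) \<times> (nat \<times> (nat \<times> dir) list)) list"
type_synonym tm_config = "nat \<times> tape list"

definition scan :: "nat list \<Rightarrow> nat" where
  "scan xs = (case xs of [] \<Rightarrow> 0 | x # _ \<Rightarrow> x)"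

definition act :: "nat \<times> dir \<Rightarrow> tape \<Rightarrow> tape" where
  "act a T = (case (a, T) of ((s, d), (ls, rs)) \<Rightarrow>
     (case d of
        Go_Left \<Rightarrow> (tl ls, scan ls # s # tl rs)
      | Stay \<Rightarrow> (ls, s # tl rs)
      | Go_Right \<Rightarrow> (s # ls, tl rs)))"

definition wf_tm :: "nat \<Rightarrow> tm \<Rightarrow> bool" where
  "wf_tm k M \<longleftrightarrow> 1 \<le> k \<and>
     (\<forall>((q, rs), (q', as)) \<in> set M. length rs = k \<and> length as = k)"

definition tm_step :: "tm \<Rightarrow> tm_config \<Rightarrow> tm_config option" where
  "tm_step M c = (case c of (q, Ts) \<Rightarrow>
     (case map_of M (q, map (\<lambda>T. scan (snd T)) Ts) of
        None \<Rightarrow> None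
      | Some (q', as) \<Rightarrow> Some (q', map2 act as Ts)))"

text \<open>
  Input \<open>n\<close>: \<open>n\<close> ones on the first tape, head on the leftmost one, all other tapes blank.
  Output: the length of the block of ones on the first tape that starts at the head.
\<close>

definition tm_init :: "nat \<Rightarrow> nat \<Rightarrow> tm_config" where
  "tm_init k n = (0, ([], replicate n 1) # replicate (k - 1) ([], []))"

definition tm_output :: "tm_config \<Rightarrow> nat" where
  "tm_output c = length (takeWhile (\<lambda>s. s = 1) (snd (hd (snd c))))"

definition tm_computes :: "nat \<Rightarrow> tm \<Rightarrow> (nat \<Rightarrow> nat) \<Rightarrow> bool" where
  "tm_computes k M f \<longleftrightarrow>
     (\<forall>n. \<exists>c. (\<lambda>a b. tm_step M a = Some b)\<^sup>*\<^sup>* (tm_init k n) c \<and>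
              tm_step M c = None \<and> tm_output c = f n)"

definition tm_computable :: "(nat \<Rightarrow> nat) \<Rightarrow> bool" where
  "tm_computable f \<longleftrightarrow> (\<exists>k M. wf_tm k M \<and> tm_computes k M f)"


section \<open>Computable points, functions and open sets of the plane\<close>

text \<open>
  Machines read and write rational data through the explicit bijections of
  \<open>Nat_Bijection\<close>; every rational number, rational point and rational polynomial has a code.
\<close>

definition rat_of_code :: "nat \<Rightarrow> real" where
  "rat_of_code c = (case prod_decode c of (a, b) \<Rightarrow> real_of_int (int_decode a) / real (Suc b))"

definition point_of_code :: "nat \<Rightarrow> real \<times> real" where
  "point_of_code c = (case prod_decode c of (a, b) \<Rightarrow> (rat_of_code a, rat_of_code b))"

text \<open>A polynomial in two variables is coded by a list of monomials (exponents, coefficient).\<close>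

definition monomial_of_code :: "nat \<Rightarrow> real \<times> real \<Rightarrow> real" where
  "monomial_of_code c z = (case prod_decode c of (e, a) \<Rightarrow> case prod_decode e of (i, j) \<Rightarrow>
     rat_of_code a * fst z ^ i * snd z ^ j)"

definition poly_of_code :: "nat \<Rightarrow> real \<times> real \<Rightarrow> real" where
  "poly_of_code c z = (\<Sum>m\<leftarrow>list_decode c. monomial_of_code m z)"

definition poly_map_of_code :: "nat \<Rightarrow> real \<times> real \<Rightarrow> real \<times> real" where
  "poly_map_of_code c z = (case prod_decode c of (a, b) \<Rightarrow> (poly_of_code a z, poly_of_code b z))"

definition computable_point :: "real \<times> real \<Rightarrow> bool" where
  "computable_point s \<longleftrightarrow>
     (\<exists>f. tm_computable f \<and> (\<forall>k. dist (point_of_code (f k)) s \<le> 1 / 2 ^ k))"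

definition computable_point_seq :: "(nat \<Rightarrow> real \<times> real) \<Rightarrow> bool" where
  "computable_point_seq x \<longleftrightarrow>
     (\<exists>f. tm_computable f \<and>
        (\<forall>n k. dist (point_of_code (f (prod_encode (n, k)))) (x n) \<le> 1 / 2 ^ k))"

definition computable_map :: "(real \<times> real \<Rightarrow> real \<times> real) \<Rightarrow> bool" where
  "computable_map h \<longleftrightarrow>
     (\<exists>f. tm_computable f \<and>
        (\<forall>k l. \<forall>x \<in> cball 0 (2 ^ l).
           dist (poly_map_of_code (f (prod_encode (k, l))) x) (h x) \<le> 1 / 2 ^ k))"

text \<open>
  An infinite sequence of nondegenerate balls cannot have empty union, and no sequence of points
  lies in an empty complement. The two disjuncts below therefore stand for the empty sequence;
  without the second one the whole plane would fail to be computable.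
\<close>

definition computable_open_set :: "(real \<times> real) set \<Rightarrow> bool" where
  "computable_open_set W \<longleftrightarrow>
     (W = {} \<or>
       (\<exists>c r. tm_computable c \<and> tm_computable r \<and>
          (\<forall>n. 0 < rat_of_code (r n)) \<and>
          W = (\<Union>n. ball (point_of_code (c n)) (rat_of_code (r n))))) \<and>
     (- W = {} \<or>
       (\<exists>x. computable_point_seq x \<and> range x \<subseteq> - W \<and> - W \<subseteq> closure (range x)))"


section \<open>Smooth functions and inward-pointing vector fields\<close>

primrec C_k :: "nat \<Rightarrow> ('a::real_normed_vector \<Rightarrow> 'b::real_normed_vector) \<Rightarrow> bool" where
  "C_k 0 f \<longleftrightarrow> continuous_on UNIV f"
| "C_k (Suc n) f \<longleftrightarrow>
     (\<forall>x. f differentiable (at x)) \<and> (\<forall>v. C_k n (\<lambda>x. frechet_derivative f (at x) v))"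

definition C_infinity :: "('a::real_normed_vector \<Rightarrow> 'b::real_normed_vector) \<Rightarrow> bool" where
  "C_infinity f \<longleftrightarrow> (\<forall>n. C_k n f)"

definition C1_on :: "'a set \<Rightarrow> ('a::real_normed_vector \<Rightarrow> 'b::real_normed_vector) \<Rightarrow> bool" where
  "C1_on S f \<longleftrightarrow>
     (\<exists>f'. (\<forall>x\<in>S. (f has_derivative blinfun_apply (f' x)) (at x within S)) \<and> continuous_on S f')"

abbreviation disk :: "(real \<times> real) set" where
  "disk \<equiv> cball 0 3"

text \<open>
  Functions \<open>disk \<Rightarrow> real \<times> real\<close> are represented by extensional functions, and a map \<open>h\<close> of the
  plane is viewed as a vector field on the disk through \<open>restrict h disk\<close>. The outward normal of
  the disk at a boundary point \<open>x\<close> is a positive multiple of \<open>x\<close>.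
\<close>

definition inward_fields :: "(real \<times> real \<Rightarrow> real \<times> real) set" where
  "inward_fields =
     {f \<in> extensional disk. C1_on disk f \<and> (\<forall>x \<in> frontier disk. f x \<bullet> x < 0)}"

definition max_norm :: "real \<times> real \<Rightarrow> real" where
  "max_norm y = max \<bar>fst y\<bar> \<bar>snd y\<bar>"

definition C_norm :: "(real \<times> real \<Rightarrow> real \<times> real) \<Rightarrow> real" where
  "C_norm f = (SUP x\<in>disk. max_norm (f x))"

definition C_neighborhood ::
  "(real \<times> real \<Rightarrow> real \<times> real) \<Rightarrow> (real \<times> real \<Rightarrow> real \<times> real) set \<Rightarrow> bool" where
  "C_neighborhood f U \<longleftrightarrow>
     U \<subseteq> inward_fields \<and>
     (\<exists>e>0. {g \<in> inward_fields. C_norm (\<lambda>x. g x - f x) < e} \<subseteq> U)"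


section \<open>Equilibria and basins of attraction\<close>

definition equilibrium :: "('a::real_normed_vector \<Rightarrow> 'a) \<Rightarrow> 'a \<Rightarrow> bool" where
  "equilibrium h s \<longleftrightarrow> h s = 0"

definition trajectory :: "('a::real_normed_vector \<Rightarrow> 'a) \<Rightarrow> 'a \<Rightarrow> (real \<Rightarrow> 'a) \<Rightarrow> bool" where
  "trajectory h x0 x \<longleftrightarrow>
     x 0 = x0 \<and> (\<forall>t\<ge>0. (x has_vector_derivative h (x t)) (at t within {0..}))"

definition basin :: "('a::real_normed_vector \<Rightarrow> 'a) \<Rightarrow> 'a \<Rightarrow> 'a set" where
  "basin h s = {x0. \<exists>x. trajectory h x0 x \<and> (x \<longlongrightarrow> s) at_top}"

definition sink :: "('a::real_normed_vector \<Rightarrow> 'a) \<Rightarrow> 'a \<Rightarrow> bool" where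
  "sink h s \<longleftrightarrow> equilibrium h s \<and> (\<exists>N. open N \<and> s \<in> N \<and> N \<subseteq> basin h s)"

end

theory Submission
  imports Defs "HOL-Computational_Algebra.Polynomial"
begin

text \<open>
  The field is \<open>h z = - G (\<parallel>z\<parallel>\<^sup>2) z + J z\<close> with \<open>J\<close> the rotation by a right angle, where
  \<open>G\<close> is positive on \<open>[0, Q)\<close> and vanishes from \<open>Q\<close> on. The circles of squared radius at least
  \<open>Q\<close> are periodic orbits and all other orbits spiral into the origin, so the basin is the disc of
  squared radius \<open>Q\<close>. Taking \<open>G u = (\<Sum>s. 2 ^ - (s + 1) exp (- 1 / (q s - u)))\<close>, the sum over the
  \<open>s\<close> with \<open>u < q s\<close>, for a computable increasing sequence \<open>q\<close> of rationals with limit \<open>Q\<close>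
  makes \<open>h\<close> smooth, and Bernstein polynomials of \<open>G\<close> make it computable. A
  diagonalisation without injuries chooses \<open>q\<close>: as soon as the machine \<open>e\<close>, read as a sequence of points dense in the
  complement of the basin, outputs a point of squared norm certainly below \<open>q s + 2 ^ - e\<close>, that
  number becomes the next value of \<open>q\<close>, which puts the point into the basin. A dense sequence in the
  complement would output such a point. Since \<open>h\<close> belongs to each of its neighbourhoods, \<open>h\<close> itself
  serves as the perturbed field.
\<close>

section \<open>Loop programs on Turing machines\<close>

text \<open>\<open>Q\<close> is only a limit of increasing rationals, so no algorithm may refer to
  it. Each summand of \<open>G\<close> sees a single \<open>q s\<close>, and the weights bound the
  tail uniformly: \<open>G\<close> is computable although no computable sequence is dense in the
  complement of the disc on which it is positive. A requirement acts at most once and adds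
  \<open>2 ^ - e\<close>, so all actions together add at most 2. A later action only enlarges the
  disc, hence never expels a point captured earlier; this is why there are no injuries. The start
  value 10 keeps the critical circle outside \<open>disk\<close>, whose squared radius is 9, so that
  the field points strictly inward there. Unbounded search is avoided: a stage number codes a
  machine, an input and a step bound, so everything to be computed is primitive recursive. Two
  translations are needed, from primitive recursion to Turing machines for the computability claims,
  and from Turing machines to primitive recursion for the diagonalisation. Orbits inside the disc
  are written down explicitly. Outside, every trajectory has to be excluded, and the bound
  \<open>G u \<le> Q - u\<close> does this.\<close>

datatype instr = Shift nat | Mark nat | Erase nat | Jz nat nat | Jmp nat

definition next_pc :: "instr \<Rightarrow> nat \<Rightarrow> nat list \<Rightarrow> nat" where
  "next_pc i pc v = (case i of Jz r t \<Rightarrow> if v ! r = 0 then t else Suc pc | Jmp t \<Rightarrow> t | _ \<Rightarrow> Suc pc)"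

text \<open>A transition writes before it moves, and it writes on every tape. Idle tapes therefore
  get their scanned symbol back, and an increment takes two instructions: \<open>Shift\<close>
  reaches the blank on the left, \<open>Mark\<close> fills it.\<close>

definition tape_op :: "instr \<Rightarrow> nat \<Rightarrow> nat \<Rightarrow> nat \<times> dir" where
  "tape_op i j x = (case i of
     Shift r \<Rightarrow> if j = r then (x, Go_Left) else (x, Stay)
   | Mark r \<Rightarrow> if j = r then (1, Stay) else (x, Stay)
   | Erase r \<Rightarrow> if j = r then (0, Go_Right) else (x, Stay)
   | _ \<Rightarrow> (x, Stay))"

text \<open>Positions past the end of \<open>P\<close> have no entry, so running off the program is
  how the machine halts. Only the symbols 0 and 1 are covered; registers never show any
  other.\<close>

definition machine :: "nat \<Rightarrow> instr list \<Rightarrow> tm" where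
  "machine k P = map (\<lambda>(pc, v). ((pc, v), (next_pc (P ! pc) pc v, map (\<lambda>j. tape_op (P ! pc) j (v ! j)) [0..<k])))
     (List.product [0..<length P] (List.n_lists k [0, 1]))"

text \<open>A register is a tape with the head on the leftmost one; cells that were erased or visited
  hold explicit blanks.\<close>

definition holds :: "tape \<Rightarrow> nat \<Rightarrow> bool" where
  "holds T n \<longleftrightarrow> set (fst T) \<subseteq> {0} \<and> (\<exists>m. snd T = replicate n 1 @ replicate m 0)"

definition holds_all :: "nat \<Rightarrow> tape list \<Rightarrow> (nat \<Rightarrow> nat) \<Rightarrow> bool" where
  "holds_all k Ts s \<longleftrightarrow> length Ts = k \<and> (\<forall>i<k. holds (Ts ! i) (s i))"

abbreviation reach :: "tm \<Rightarrow> tm_config \<Rightarrow> tm_config \<Rightarrow> bool" where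
  "reach M \<equiv> (\<lambda>a b. tm_step M a = Some b)\<^sup>*\<^sup>*"

lemma wf_machine: "1 \<le> k \<Longrightarrow> wf_tm k (machine k P)"
  by (auto simp: wf_tm_def machine_def set_n_lists)

lemma scan_holds: "holds T n \<Longrightarrow> scan (snd T) = (if n = 0 then 0 else 1)"
proof -
  assume "holds T n"
  then obtain m where "snd T = replicate n 1 @ replicate m 0" by (auto simp: holds_def)
  then show ?thesis by (cases n; cases m) (auto simp: scan_def)
qed

lemma map_of_machine:
  "map_of (machine k P) (pc, v) =
    (if pc < length P \<and> length v = k \<and> set v \<subseteq> {0, 1}
     then Some (next_pc (P ! pc) pc v, map (\<lambda>j. tape_op (P ! pc) j (v ! j)) [0..<k]) else None)"
proof -
  have "machine k P = map (\<lambda>x. (x, (next_pc (P ! fst x) (fst x) (snd x), map (\<lambda>j. tape_op (P ! fst x) j (snd x ! j)) [0..<k])))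
     (List.product [0..<length P] (List.n_lists k [0, 1]))"
    by (auto simp: machine_def)
  then show ?thesis
    by (auto simp: map_of_map_restrict restrict_map_def set_n_lists)
qed

definition instr_eff :: "instr \<Rightarrow> nat \<Rightarrow> tape \<Rightarrow> tape" where
  "instr_eff i j T = act (tape_op i j (scan (snd T))) T"

lemma machine_step:
  assumes "pc < length P" "holds_all k Ts s"
  shows "tm_step (machine k P) (pc, Ts) =
    Some (next_pc (P ! pc) pc (map (\<lambda>T. scan (snd T)) Ts),
          map (\<lambda>j. instr_eff (P ! pc) j (Ts ! j)) [0..<k])"
proof -
  let ?v = "map (\<lambda>T. scan (snd T)) Ts"
  have len: "length Ts = k" and h: "\<And>i. i < k \<Longrightarrow> holds (Ts ! i) (s i)"
    using assms by (auto simp: holds_all_def)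
  have "scan (snd T) \<in> {0, 1}" if "T \<in> set Ts" for T
    using that h len by (metis in_set_conv_nth insertCI scan_holds)
  then have "set ?v \<subseteq> {0, 1}" unfolding set_map by (rule image_subsetI)
  moreover have "map2 act (map (\<lambda>j. tape_op (P ! pc) j (?v ! j)) [0..<k]) Ts =
     map (\<lambda>j. instr_eff (P ! pc) j (Ts ! j)) [0..<k]"
    by (rule nth_equalityI) (auto simp: len instr_eff_def)
  ultimately show ?thesis
    using assms(1) len by (simp add: tm_step_def map_of_machine)
qed

text \<open>If the right half is the empty list, rewriting produces an explicit blank; this is why
  \<open>holds\<close> admits trailing zeros.\<close>

lemma holds_write_scan: "holds T n \<Longrightarrow> holds (act (scan (snd T), Stay) T) n"
proof (cases T)
  case (Pair ls rs)
  assume "holds T n"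
  then obtain m where 1: "set ls \<subseteq> {0}" "rs = replicate n 1 @ replicate m 0"
    by (auto simp: holds_def Pair)
  show ?thesis
  proof (cases "rs = []")
    case True
    then show ?thesis using 1 by (auto simp: act_def Pair holds_def scan_def intro: exI[of _ 1])
  next
    case False
    then have "scan rs # tl rs = rs" by (cases rs) (auto simp: scan_def)
    then show ?thesis using 1 by (auto simp: act_def Pair holds_def)
  qed
qed

lemma scan_blank: "set ls \<subseteq> {0} \<Longrightarrow> scan ls = 0"
  by (cases ls) (auto simp: scan_def)

lemma set_tl_blank: "set ls \<subseteq> {0} \<Longrightarrow> set (tl ls) \<subseteq> {0}"
  by (cases ls) auto

lemma holds_shift_mark:
  assumes "holds T n"
  shows "holds (act (1, Stay) (act (scan (snd T), Go_Left) T)) (Suc n)"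
proof (cases T)
  case (Pair ls rs)
  obtain m where 1: "set ls \<subseteq> {0}" "rs = replicate n 1 @ replicate m 0"
    using assms by (auto simp: holds_def Pair)
  have "\<exists>m'. scan rs # tl rs = replicate n 1 @ replicate m' 0"
  proof (cases n)
    case 0
    then have "scan rs # tl rs = replicate n 1 @ replicate (max 1 m) 0"
      using 1 by (cases m) (auto simp: scan_def)
    then show ?thesis by blast
  next
    case (Suc n')
    then have "scan rs # tl rs = replicate n 1 @ replicate m 0" using 1 by (simp add: scan_def)
    then show ?thesis by blast
  qed
  then show ?thesis using 1 set_tl_blank[of ls]
    by (auto simp: act_def Pair holds_def)
qed

lemma holds_erase: "holds T n \<Longrightarrow> holds (act (0, Go_Right) T) (n - 1)"
proof (cases T)
  case (Pair ls rs)
  assume "holds T n"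
  then obtain m where 1: "set ls \<subseteq> {0}" "rs = replicate n 1 @ replicate m 0"
    by (auto simp: holds_def Pair)
  then have "tl rs = replicate (n - 1) 1 @ replicate (if n = 0 then m - 1 else m) 0"
    by (cases n; cases m) auto
  then have "\<exists>m'. tl rs = replicate (n - 1) 1 @ replicate m' 0" by blast
  then show ?thesis using 1 by (auto simp: act_def Pair holds_def)
qed

section \<open>A loop language and its compilation\<close>

datatype cmd = Skip | Inc nat | Dec nat | Seq cmd cmd (infixr \<open>;;\<close> 60) | Loop nat cmd

primrec exec :: "cmd \<Rightarrow> (nat \<Rightarrow> nat) \<Rightarrow> (nat \<Rightarrow> nat)" where
  "exec Skip s = s"
| "exec (Inc r) s = s(r := Suc (s r))"
| "exec (Dec r) s = s(r := s r - 1)"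
| "exec (c ;; d) s = exec d (exec c s)"
| "exec (Loop r c) s = ((\<lambda>s. exec c (s(r := s r - 1))) ^^ s r) s"

text \<open>The loop counter is tested again in every round, so \<open>exec\<close> describes the actual run
  only if the body preserves it.\<close>

primrec counter_safe :: "cmd \<Rightarrow> bool" where
  "counter_safe Skip = True"
| "counter_safe (Inc r) = True"
| "counter_safe (Dec r) = True"
| "counter_safe (c ;; d) = (counter_safe c \<and> counter_safe d)"
| "counter_safe (Loop r c) = (counter_safe c \<and> (\<forall>s. exec c s r = s r))"

primrec regs_below :: "nat \<Rightarrow> cmd \<Rightarrow> bool" where
  "regs_below k Skip = True"
| "regs_below k (Inc r) = (r < k)"
| "regs_below k (Dec r) = (r < k)"
| "regs_below k (c ;; d) = (regs_below k c \<and> regs_below k d)"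
| "regs_below k (Loop r c) = (r < k \<and> regs_below k c)"

primrec code_size :: "cmd \<Rightarrow> nat" where
  "code_size Skip = 0"
| "code_size (Inc r) = 2"
| "code_size (Dec r) = 1"
| "code_size (c ;; d) = code_size c + code_size d"
| "code_size (Loop r c) = code_size c + 3"

text \<open>Jump targets are absolute, so \<open>a\<close> is the address at which the code is
  placed; \<open>code_size\<close> gives the exit address of a loop before its body is
  compiled.\<close>

primrec code :: "nat \<Rightarrow> cmd \<Rightarrow> instr list" where
  "code a Skip = []"
| "code a (Inc r) = [Shift r, Mark r]"
| "code a (Dec r) = [Erase r]"
| "code a (c ;; d) = code a c @ code (a + code_size c) d"
| "code a (Loop r c) = [Jz r (a + code_size c + 3), Erase r] @ code (a + 2) c @ [Jmp a]"

lemma length_code [simp]: "length (code a c) = code_size c"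
  by (induction c arbitrary: a) auto

lemma regs_below_mono: "regs_below k c \<Longrightarrow> k \<le> k' \<Longrightarrow> regs_below k' c"
  by (induction c) auto

lemma ex_regs_below: "\<exists>k. regs_below k c"
proof (induction c)
  case (Seq c d)
  then show ?case by (metis regs_below.simps(4) regs_below_mono max.cobounded1 max.cobounded2)
next
  case (Loop r c)
  then obtain k where "regs_below k c" by blast
  then have "regs_below (max k (Suc r)) (Loop r c)" by (auto intro: regs_below_mono)
  then show ?case by blast
qed auto

lemma holds_all_map:
  assumes "holds_all k Ts s" "\<And>j T. j < k \<Longrightarrow> holds T (s j) \<Longrightarrow> holds (f j T) (s' j)"
  shows "holds_all k (map (\<lambda>j. f j (Ts ! j)) [0..<k]) s'"
  using assms by (simp add: holds_all_def)

lemma holds_all_jump: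
  assumes "holds_all k Ts s"
  shows "holds_all k (map (\<lambda>j. instr_eff (Jz r t) j (Ts ! j)) [0..<k]) s"
    and "holds_all k (map (\<lambda>j. instr_eff (Jmp t) j (Ts ! j)) [0..<k]) s"
  using assms by (auto intro!: holds_all_map holds_write_scan simp: instr_eff_def tape_op_def)

lemma holds_all_erase:
  assumes "holds_all k Ts s"
  shows "holds_all k (map (\<lambda>j. instr_eff (Erase r) j (Ts ! j)) [0..<k]) (s(r := s r - 1))"
  using holds_erase
  by (intro holds_all_map[OF assms]) (auto simp: holds_write_scan instr_eff_def tape_op_def)

text \<open>The surrounding code \<open>xs\<close> and \<open>ys\<close> is arbitrary so that the
  induction hypotheses apply to subprograms in place. A loop needs an inner induction on the counter
  value.\<close>

lemma code_correct:
  assumes "counter_safe c" "regs_below k c" "P = xs @ code (length xs) c @ ys" "holds_all k Ts s"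
  shows "\<exists>Ts'. reach (machine k P) (length xs, Ts) (length xs + code_size c, Ts') \<and> holds_all k Ts' (exec c s)"
  using assms
proof (induction c arbitrary: xs ys Ts s)
  case Skip
  then show ?case by auto
next
  case (Inc r)
  let ?M = "machine k P"
  let ?n = "length xs"
  have P0: "?n < length P" "P ! ?n = Shift r" and P1: "Suc ?n < length P" "P ! Suc ?n = Mark r"
    using Inc by (auto simp: nth_append)
  define Ts1 where "Ts1 = map (\<lambda>j. instr_eff (Shift r) j (Ts ! j)) [0..<k]"
  define Ts2 where "Ts2 = map (\<lambda>j. instr_eff (Mark r) j (Ts1 ! j)) [0..<k]"
  have s1: "tm_step ?M (?n, Ts) = Some (Suc ?n, Ts1)"
    using machine_step[OF P0(1) Inc.prems(4)] by (simp add: P0(2) Ts1_def next_pc_def)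
  have len: "length Ts = k" and h: "\<And>i. i < k \<Longrightarrow> holds (Ts ! i) (s i)"
    using Inc.prems by (auto simp: holds_all_def)
  \<comment> \<open>Between \<open>Shift\<close> and \<open>Mark\<close> a blank stands before the
    ones, so tape \<open>r\<close> need not satisfy \<open>holds\<close> and
    \<open>machine_step\<close> does not apply. The second step is computed directly from the fact
    that all scanned symbols are 0 or 1.\<close>
  have v: "scan (snd (Ts1 ! i)) \<in> {0, 1}" if "i < k" for i
  proof (cases "i = r")
    case True
    have "scan (fst (Ts ! i)) = 0" using h[OF that] scan_blank by (simp add: holds_def)
    then show ?thesis using that True
      by (cases "Ts ! i") (simp add: Ts1_def instr_eff_def tape_op_def act_def, simp add: scan_def)
  next
    case False
    then have "holds (Ts1 ! i) (s i)"
      using holds_write_scan[OF h[OF that]] that by (simp add: Ts1_def instr_eff_def tape_op_def)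
    then show ?thesis by (simp add: scan_holds)
  qed
  have s2: "tm_step ?M (Suc ?n, Ts1) = Some (Suc (Suc ?n), Ts2)"
  proof -
    let ?v = "map (\<lambda>T. scan (snd T)) Ts1"
    have l1: "length Ts1 = k" by (simp add: Ts1_def)
    have "set ?v \<subseteq> {0, 1}"
      unfolding set_map using v l1 by (intro image_subsetI) (metis in_set_conv_nth)
    moreover have "map2 act (map (\<lambda>j. tape_op (Mark r) j (?v ! j)) [0..<k]) Ts1 = Ts2"
      by (rule nth_equalityI) (auto simp: l1 Ts2_def instr_eff_def)
    ultimately show ?thesis using P1 l1
      by (simp add: tm_step_def map_of_machine next_pc_def)
  qed
  have "holds_all k Ts2 (exec (Inc r) s)"
    unfolding holds_all_def
  proof (intro conjI allI impI)
    show "length Ts2 = k" by (simp add: Ts2_def)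
    fix i assume i: "i < k"
    show "holds (Ts2 ! i) (exec (Inc r) s i)"
      using holds_shift_mark[OF h[OF i]] holds_write_scan[OF holds_write_scan[OF h[OF i]]] i
      by (auto simp: Ts2_def Ts1_def instr_eff_def tape_op_def)
  qed
  moreover have "reach ?M (?n, Ts) (?n + code_size (Inc r), Ts2)"
    using s1 s2 by (auto intro: converse_rtranclp_into_rtranclp)
  ultimately show ?case by blast
next
  case (Dec r)
  have P0: "length xs < length P" "P ! length xs = Erase r"
    using Dec by (auto simp: nth_append)
  define Ts1 where "Ts1 = map (\<lambda>j. instr_eff (Erase r) j (Ts ! j)) [0..<k]"
  have s1: "tm_step (machine k P) (length xs, Ts) = Some (Suc (length xs), Ts1)"
    using machine_step[OF P0(1) Dec.prems(4)] by (simp add: P0(2) Ts1_def next_pc_def)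
  have "holds_all k Ts1 (exec (Dec r) s)"
    using holds_all_erase[OF Dec.prems(4)] unfolding Ts1_def exec.simps .
  moreover have "reach (machine k P) (length xs, Ts) (length xs + code_size (Dec r), Ts1)" using s1 by auto
  ultimately show ?case by blast
next
  case (Seq c d)
  obtain Ts1 where 1: "reach (machine k P) (length xs, Ts) (length xs + code_size c, Ts1)"
    "holds_all k Ts1 (exec c s)"
    using Seq.IH(1)[of xs "code (length xs + code_size c) d @ ys" Ts s] Seq.prems by auto
  obtain Ts2 where 2: "reach (machine k P) (length xs + code_size c, Ts1) (length xs + code_size c + code_size d, Ts2)"
    "holds_all k Ts2 (exec d (exec c s))"
    using Seq.IH(2)[of "xs @ code (length xs) c" ys Ts1 "exec c s"] Seq.prems 1 by auto
  have "reach (machine k P) (length xs, Ts) (length xs + code_size c + code_size d, Ts2)"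
    using 1(1) 2(1) by (rule rtranclp_trans)
  then show ?case using 2(2) by (auto simp: add.assoc)
next
  case (Loop r c)
  let ?M = "machine k P" and ?n = "length xs"
  let ?out = "?n + code_size c + 3"
  have P0: "?n < length P" "P ! ?n = Jz r ?out"
    and P1: "Suc ?n < length P" "P ! Suc ?n = Erase r"
    and P2: "?n + 2 + code_size c < length P" "P ! (?n + 2 + code_size c) = Jmp ?n"
    using Loop.prems(3) by (auto simp: nth_append)
  have r: "r < k" and safe: "\<And>s. exec c s r = s r" using Loop.prems by auto
  have "\<exists>Ts'. reach ?M (?n, Ts) (?out, Ts') \<and>
      holds_all k Ts' (((\<lambda>s. exec c (s(r := s r - 1))) ^^ n) s)"
    if "n = s r" "holds_all k Ts s" for n Ts s
    using that
  proof (induction n arbitrary: s Ts)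
    case 0
    have "map (\<lambda>T. scan (snd T)) Ts ! r = 0" using 0 r scan_holds[of "Ts ! r" 0] by (auto simp: holds_all_def)
    then have "tm_step ?M (?n, Ts) = Some (?out, map (\<lambda>j. instr_eff (Jz r ?out) j (Ts ! j)) [0..<k])"
      using machine_step[OF P0(1) 0(2)] by (simp add: P0(2) next_pc_def)
    moreover have "holds_all k (map (\<lambda>j. instr_eff (Jz r ?out) j (Ts ! j)) [0..<k]) s"
      using holds_all_jump(1) 0 by blast
    ultimately show ?case by auto
  next
    case (Suc n)
    have nz: "map (\<lambda>T. scan (snd T)) Ts ! r \<noteq> 0"
      using Suc.prems r scan_holds[of "Ts ! r" "s r"] by (auto simp: holds_all_def)
    define Ts1 where "Ts1 = map (\<lambda>j. instr_eff (Jz r ?out) j (Ts ! j)) [0..<k]"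
    have s1: "tm_step ?M (?n, Ts) = Some (Suc ?n, Ts1)"
      using machine_step[OF P0(1) Suc.prems(2)] nz by (simp add: P0(2) next_pc_def Ts1_def)
    have h1: "holds_all k Ts1 s" using holds_all_jump(1)[OF Suc.prems(2)] by (simp add: Ts1_def)
    define Ts2 where "Ts2 = map (\<lambda>j. instr_eff (Erase r) j (Ts1 ! j)) [0..<k]"
    have s2: "tm_step ?M (Suc ?n, Ts1) = Some (Suc (Suc ?n), Ts2)"
      using machine_step[OF P1(1) h1] by (simp add: P1(2) Ts2_def next_pc_def)
    have h2: "holds_all k Ts2 (s(r := s r - 1))"
      using holds_all_erase[OF h1] by (simp add: Ts2_def)
    have "P = (xs @ [Jz r ?out, Erase r]) @ code (length (xs @ [Jz r ?out, Erase r])) c @ Jmp ?n # ys"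
      using Loop.prems(3) by simp
    note Loop.IH[OF _ _ this h2]
    moreover have "counter_safe c" "regs_below k c" using Loop.prems by simp_all
    ultimately have "\<exists>Ts3. reach ?M (length (xs @ [Jz r ?out, Erase r]), Ts2)
        (length (xs @ [Jz r ?out, Erase r]) + code_size c, Ts3) \<and> holds_all k Ts3 (exec c (s(r := s r - 1)))"
      by blast
    then obtain Ts3 where s3: "reach ?M (?n + 2, Ts2) (?n + 2 + code_size c, Ts3)"
      and h3: "holds_all k Ts3 (exec c (s(r := s r - 1)))"
      by (auto simp del: fun_upd_apply)
    define Ts4 where "Ts4 = map (\<lambda>j. instr_eff (Jmp ?n) j (Ts3 ! j)) [0..<k]"
    have s4: "tm_step ?M (?n + 2 + code_size c, Ts3) = Some (?n, Ts4)"
      using machine_step[OF P2(1) h3] unfolding P2(2) by (simp add: Ts4_def next_pc_def)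
    have h4: "holds_all k Ts4 (exec c (s(r := s r - 1)))" using holds_all_jump(2)[OF h3] by (simp add: Ts4_def)
    have "n = exec c (s(r := s r - 1)) r" using safe Suc.prems by simp
    from Suc.IH[OF this h4] obtain Ts' where
      5: "reach ?M (?n, Ts4) (?out, Ts')"
      "holds_all k Ts' (((\<lambda>s. exec c (s(r := s r - 1))) ^^ n) (exec c (s(r := s r - 1))))" by blast
    have "reach ?M (?n, Ts) (?n + 2, Ts2)"
      using s1 s2 by (auto intro: converse_rtranclp_into_rtranclp)
    also note s3
    also have "reach ?M (?n + 2 + code_size c, Ts3) (?n, Ts4)" using s4 by blast
    also note 5(1)
    finally show ?case using 5(2) unfolding funpow_Suc_right o_apply by blast
  qed
  from this[OF refl Loop.prems(4)] show ?case by (simp add: add.assoc)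
qed

text \<open>Register 0 is the tape that carries both input and output, and the run ends just past
  the last instruction, where no table entry matches.\<close>

lemma tm_computable_exec:
  assumes "counter_safe c" "\<And>n. exec c (\<lambda>i. if i = 0 then n else 0) 0 = f n"
  shows "tm_computable f"
proof -
  obtain k0 where "regs_below k0 c" using ex_regs_below by blast
  then have k: "regs_below (Suc k0) c" by (rule regs_below_mono) simp
  let ?k = "Suc k0" and ?P = "code 0 c"
  have "\<exists>b. reach (machine ?k ?P) (tm_init ?k n) b \<and> tm_step (machine ?k ?P) b = None \<and> tm_output b = f n" for n
  proof -
    let ?s = "\<lambda>i. if i = 0 then n else (0::nat)"
    have "holds_all ?k (([], replicate n 1) # replicate k0 ([], [])) ?s"
      by (auto simp: holds_all_def holds_def nth_Cons split: nat.split intro: exI[of _ 0])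
    then obtain Ts where 1: "reach (machine ?k ?P) (tm_init ?k n) (code_size c, Ts)" "holds_all ?k Ts (exec c ?s)"
      using code_correct[of c ?k ?P "[]" "[]" _ ?s] assms(1) k by (auto simp: tm_init_def)
    have "tm_step (machine ?k ?P) (code_size c, Ts) = None"
      by (simp add: tm_step_def map_of_machine)
    moreover have "tm_output (code_size c, Ts) = f n"
    proof -
      have "holds (hd Ts) (f n)" using 1(2) assms(2)[of n]
        by (cases Ts) (auto simp: holds_all_def)
      then obtain m where "snd (hd Ts) = replicate (f n) 1 @ replicate m 0" by (auto simp: holds_def)
      then show ?thesis by (cases m) (auto simp: tm_output_def takeWhile_append)
    qed
    ultimately show ?thesis using 1 by blast
  qed
  then show ?thesis
    unfolding tm_computable_def tm_computes_def using wf_machine[of ?k ?P] by auto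
qed

section \<open>Primitive recursive functions\<close>

text \<open>Functions of an environment; the recursion body sees the counter and the previous value as
  the variables 0 and 1, followed by the outer environment.\<close>

inductive prim_rec :: "((nat \<Rightarrow> nat) \<Rightarrow> nat) \<Rightarrow> bool" where
  var: "prim_rec (\<lambda>e. e i)"
| zero: "prim_rec (\<lambda>e. 0)"
| suc: "prim_rec F \<Longrightarrow> prim_rec (\<lambda>e. Suc (F e))"
| recn: "prim_rec A \<Longrightarrow> prim_rec B \<Longrightarrow> prim_rec N \<Longrightarrow>
    prim_rec (\<lambda>e. rec_nat (A e) (\<lambda>k r. B (case_nat k (case_nat r e))) (N e))"

lemma exec_clear [simp]: "exec (Loop r Skip) s = s(r := 0)"
proof -
  have "((\<lambda>s. exec Skip (s(r := s r - 1))) ^^ n) s = s(r := s r - n)" for n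
    by (induction n) auto
  then show ?thesis by simp
qed

definition move :: "nat \<Rightarrow> nat \<Rightarrow> cmd" where
  "move a b = (Loop b Skip ;; Loop a (Inc b))"

lemma exec_move [simp]: "a \<noteq> b \<Longrightarrow> exec (move a b) s = s(a := 0, b := s a)"
proof -
  assume ab: "a \<noteq> b"
  have "((\<lambda>s. exec (Inc b) (s(a := s a - 1))) ^^ n) s = s(a := s a - n, b := s b + n)" for n s
    using ab by (induction n) auto
  then have "exec (Loop a (Inc b)) s = s(a := 0, b := s b + s a)" for s
    unfolding exec.simps(5) by simp
  then show ?thesis using ab by (simp add: move_def fun_upd_twist del: exec.simps(5))
qed

definition copy :: "nat \<Rightarrow> nat \<Rightarrow> nat \<Rightarrow> cmd" where
  "copy a b t = (Loop b Skip ;; Loop t Skip ;; Loop a (Inc b ;; Inc t) ;; move t a)"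

lemma exec_copy [simp]:
  "a \<noteq> b \<Longrightarrow> a \<noteq> t \<Longrightarrow> b \<noteq> t \<Longrightarrow> exec (copy a b t) s = s(t := 0, b := s a)"
proof -
  assume ab: "a \<noteq> b" "a \<noteq> t" "b \<noteq> t"
  have "((\<lambda>s. exec (Inc b ;; Inc t) (s(a := s a - 1))) ^^ n) s = s(a := s a - n, b := s b + n, t := s t + n)" for n s
    using ab by (induction n) (auto simp: fun_eq_iff)
  then have "exec (Loop a (Inc b ;; Inc t)) s = s(a := 0, b := s b + s a, t := s t + s a)" for s
    unfolding exec.simps(5) by simp
  then show ?thesis using ab by (auto simp: copy_def fun_eq_iff simp del: exec.simps(5))
qed

lemma counter_safe_move [simp]: "a \<noteq> b \<Longrightarrow> counter_safe (move a b)"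
  by (simp add: move_def)

lemma counter_safe_copy [simp]: "a \<noteq> b \<Longrightarrow> a \<noteq> t \<Longrightarrow> counter_safe (copy a b t)"
  by (simp add: copy_def)

text \<open>Compilation with a stack discipline: \<open>\<rho>\<close> places the variables in
  registers below \<open>n\<close>, the result goes to register \<open>n\<close>, and everything
  from \<open>n\<close> upwards is scratch. Scratch registers may hold garbage, so each is set
  before it is read.\<close>

lemma prim_rec_program:
  assumes "prim_rec F" "\<And>i. \<rho> i < n"
  shows "\<exists>p. counter_safe p \<and> (\<forall>s. exec p s n = F (\<lambda>i. s (\<rho> i)) \<and> (\<forall>r<n. exec p s r = s r))"
  using assms
proof (induction arbitrary: \<rho> n rule: prim_rec.induct)
  case (var i)
  have "\<rho> i < n" using var by blast
  then show ?case by (intro exI[of _ "copy (\<rho> i) n (Suc n)"]) auto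
next
  case zero
  show ?case by (intro exI[of _ "Loop n Skip"]) (auto simp del: exec.simps(5))
next
  case (suc F)
  obtain p where
    "counter_safe p" "\<forall>s. exec p s n = F (\<lambda>i. s (\<rho> i)) \<and> (\<forall>r<n. exec p s r = s r)"
    using suc.IH[of \<rho> n, OF suc.prems] by auto
  then show ?case by (intro exI[of _ "p ;; Inc n"]) auto
next
  case (recn A B N)
  \<comment> \<open>Register \<open>n\<close> counts the remaining rounds down, \<open>n + 1\<close>
    holds the previous value, \<open>n + 2\<close> counts up and serves as the recursion variable.
    The body leaves its result in \<open>n + 3\<close>.\<close>
  let ?\<rho> = "case_nat (n + 2) (case_nat (n + 1) \<rho>)"
  have \<rho>1: "\<rho> i < n + 1" for i using recn.prems[of i] by simp
  have \<rho>3: "?\<rho> i < n + 3" for i using recn.prems[of "i - 2"] by (auto split: nat.split)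
  obtain pn where pn: "counter_safe pn"
    "\<And>s. exec pn s n = N (\<lambda>i. s (\<rho> i))" "\<And>s r. r < n \<Longrightarrow> exec pn s r = s r"
    using recn.IH(3)[of \<rho> n, OF recn.prems] by auto
  obtain pa where pa: "counter_safe pa"
    "\<And>s. exec pa s (n + 1) = A (\<lambda>i. s (\<rho> i))" "\<And>s r. r < n + 1 \<Longrightarrow> exec pa s r = s r"
    using recn.IH(1)[of \<rho> "n + 1", OF \<rho>1] by auto
  obtain pb where pb: "counter_safe pb"
    "\<And>s. exec pb s (n + 3) = B (\<lambda>i. s (?\<rho> i))" "\<And>s r. r < n + 3 \<Longrightarrow> exec pb s r = s r"
    using recn.IH(2)[of ?\<rho> "n + 3", OF \<rho>3] by auto
  let ?body = "pb ;; move (n + 3) (n + 1) ;; Inc (n + 2)"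
  let ?p = "pn ;; pa ;; Loop (n + 2) Skip ;; Loop n ?body ;; move (n + 1) n"
  have safe: "counter_safe ?p" using pn pa pb by (auto simp: pb(3))
  define body where "body = ?body"
  have body: "exec body s (n + 1) = B (case_nat (s (n + 2)) (case_nat (s (n + 1)) (\<lambda>i. s (\<rho> i))))"
    "exec body s (n + 2) = Suc (s (n + 2))" "r \<le> n \<Longrightarrow> exec body s r = s r" for s r
  proof -
    have "(\<lambda>i. s (?\<rho> i)) = case_nat (s (n + 2)) (case_nat (s (n + 1)) (\<lambda>i. s (\<rho> i)))"
      by (auto split: nat.split)
    then show "exec body s (n + 1) = B (case_nat (s (n + 2)) (case_nat (s (n + 1)) (\<lambda>i. s (\<rho> i))))"
      by (simp add: body_def pb(2))
  qed (auto simp: body_def pb(3))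
  define step where "step = (\<lambda>s. exec body (s(n := s n - 1)))"
  have step: "step s (n + 1) = B (case_nat (s (n + 2)) (case_nat (s (n + 1)) (\<lambda>i. s (\<rho> i))))"
    "step s (n + 2) = Suc (s (n + 2))" "r < n \<Longrightarrow> step s r = s r" for s r
  proof -
    have "(s(n := s n - 1)) (\<rho> i) = s (\<rho> i)" for i
      using recn.prems[of i] by simp
    then show "step s (n + 1) = B (case_nat (s (n + 2)) (case_nat (s (n + 1)) (\<lambda>i. s (\<rho> i))))"
      by (simp only: step_def body(1)) simp
  qed (simp_all only: step_def body, simp_all)
  have loop: "(step ^^ m) s (n + 1) =
      rec_nat (s (n + 1)) (\<lambda>k r. B (case_nat k (case_nat r (\<lambda>i. s (\<rho> i))))) m \<and>
      (step ^^ m) s (n + 2) = m \<and> (\<forall>r<n. (step ^^ m) s r = s r)"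
    if "s (n + 2) = 0" for m s
  proof (induction m)
    case 0
    then show ?case using that by simp
  next
    case (Suc m)
    have e: "(\<lambda>i. (step ^^ m) s (\<rho> i)) = (\<lambda>i. s (\<rho> i))"
      using Suc recn.prems by blast
    have "(step ^^ Suc m) s = step ((step ^^ m) s)" by simp
    then show ?case using Suc step[where s = "(step ^^ m) s"] by (simp only: e) simp
  qed
  have "exec ?p s n = rec_nat (A (\<lambda>i. s (\<rho> i))) (\<lambda>k r. B (case_nat k (case_nat r (\<lambda>i. s (\<rho> i))))) (N (\<lambda>i. s (\<rho> i)))
     \<and> (\<forall>r<n. exec ?p s r = s r)" for s
  proof -
    define s1 where "s1 = exec pn s"
    define s2 where "s2 = (exec pa s1)(n + 2 := 0)"
    define s3 where "s3 = exec (Loop n body) s2"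
    have ss: "exec ?p s = s3(n + 1 := 0, n := s3 (n + 1))"
      unfolding s1_def s2_def s3_def body_def by (simp del: exec.simps(5))
    have 1: "s1 n = N (\<lambda>i. s (\<rho> i))" "\<And>r. r < n \<Longrightarrow> s1 r = s r" by (auto simp: s1_def pn)
    have 2: "s2 (n + 1) = A (\<lambda>i. s1 (\<rho> i))" "s2 (n + 2) = 0" "\<And>r. r \<le> n \<Longrightarrow> s2 r = s1 r"
      using pa by (auto simp: s2_def)
    have 3: "s1 (\<rho> i) = s (\<rho> i)" "s2 (\<rho> i) = s (\<rho> i)" for i
      using 1(2) 2(3) recn.prems[of i] by simp_all
    have "s3 = (step ^^ s2 n) s2" by (simp add: s3_def step_def)
    then have "s3 (n + 1) = rec_nat (s2 (n + 1)) (\<lambda>k r. B (case_nat k (case_nat r (\<lambda>i. s2 (\<rho> i))))) (s2 n)"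
      "\<And>r. r < n \<Longrightarrow> s3 r = s2 r"
      using loop[of s2 "s2 n"] 2(2) by auto
    then show ?thesis unfolding ss using 1 2 3 by simp
  qed
  then show ?case using safe by blast
qed

theorem tm_computable_prim_rec:
  assumes "prim_rec (\<lambda>e. f (e 0))"
  shows "tm_computable f"
proof -
  obtain p where p: "counter_safe p" "\<And>s. exec p s 1 = f (s 0)"
    using prim_rec_program[OF assms, of "\<lambda>_. 0" 1] by auto
  show ?thesis
    by (rule tm_computable_exec[of "p ;; move 1 0"]) (simp_all add: p[unfolded One_nat_def] p(1))
qed

text \<open>Mostly used as weakening: under a recursion the outer variables are shifted by
  two.\<close>

lemma prim_rec_rename: "prim_rec F \<Longrightarrow> prim_rec (\<lambda>e. F (\<lambda>i. e (\<pi> i)))"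
proof (induction arbitrary: \<pi> rule: prim_rec.induct)
  case (recn A B N)
  let ?\<pi> = "case_nat 0 (case_nat 1 (\<lambda>i. Suc (Suc (\<pi> i))))"
  have "(\<lambda>i. case_nat k (case_nat r e) (?\<pi> i)) = case_nat k (case_nat r (\<lambda>i. e (\<pi> i)))"
    for k r and e :: "nat \<Rightarrow> nat"
    by (auto simp: fun_eq_iff split: nat.split)
  then show ?case using prim_rec.recn[OF recn.IH(1)[of \<pi>] recn.IH(2)[of ?\<pi>] recn.IH(3)[of \<pi>]] by simp
qed (auto intro: prim_rec.intros)

lemma prim_rec_subst:
  "prim_rec F \<Longrightarrow> (\<And>i. prim_rec (G i)) \<Longrightarrow> prim_rec (\<lambda>e. F (\<lambda>i. G i e))"
proof (induction arbitrary: G rule: prim_rec.induct)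
  case (recn A B N)
  let ?G = "case_nat (\<lambda>e. e 0) (case_nat (\<lambda>e. e 1) (\<lambda>i e. G i (\<lambda>j. e (Suc (Suc j)))))"
  have "prim_rec (?G i)" for i
    using recn.prems prim_rec_rename[of _ "\<lambda>j. Suc (Suc j)"] by (auto intro: prim_rec.var split: nat.split)
  note B = recn.IH(2)[of ?G, OF this]
  have "(\<lambda>i. ?G i (case_nat k (case_nat r e))) = case_nat k (case_nat r (\<lambda>i. G i e))" for k r e
    by (auto simp: fun_eq_iff split: nat.split)
  then show ?case using prim_rec.recn[OF recn.IH(1)[of G, OF recn.prems] B recn.IH(3)[of G, OF recn.prems]] by (simp only:)
qed (auto intro: prim_rec.intros)

section \<open>Closure properties of primitive recursive functions\<close>

lemma prim_rec_comp1:
  assumes "prim_rec (\<lambda>e. f (e 0))" "prim_rec A"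
  shows "prim_rec (\<lambda>e. f (A e))"
  using prim_rec_subst[OF assms(1), of "\<lambda>_. A"] assms by simp

lemma prim_rec_comp2:
  assumes "prim_rec (\<lambda>e. f (e 0) (e 1))" "prim_rec A" "prim_rec B"
  shows "prim_rec (\<lambda>e. f (A e) (B e))"
  using prim_rec_subst[OF assms(1), of "case_nat A (\<lambda>_. B)"] assms by (simp split: nat.split)

lemma prim_rec_comp3:
  assumes "prim_rec (\<lambda>e. f (e 0) (e 1) (e 2))" "prim_rec A" "prim_rec B" "prim_rec C"
  shows "prim_rec (\<lambda>e. f (A e) (B e) (C e))"
  using prim_rec_subst[OF assms(1), of "case_nat A (case_nat B (\<lambda>_. C))"] assms
  by (simp split: nat.split add: numeral_2_eq_2)

lemma prim_rec_const: "prim_rec (\<lambda>e. c)"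
  by (induction c) (auto intro: prim_rec.intros)

text \<open>The rule \<open>recn\<close> with the body as a function of counter, previous value and
  environment, a form that higher-order unification can match when rules are applied by
  \<open>intro\<close>.\<close>

lemma prim_rec_rec_nat:
  assumes "prim_rec A" "prim_rec (\<lambda>e. B (e 0) (e (Suc 0)) (\<lambda>i. e (Suc (Suc i))))" "prim_rec N"
  shows "prim_rec (\<lambda>e. rec_nat (A e) (\<lambda>k r. B k r e) (N e))"
  using prim_rec.recn[OF assms] by simp

lemma prim_rec_add:
  assumes "prim_rec A" "prim_rec B" shows "prim_rec (\<lambda>e. A e + B e)"
proof -
  have "m + n = rec_nat m (\<lambda>k r. Suc r) n" for m n :: nat by (induction n) auto
  then show ?thesis using assms by (auto intro!: prim_rec_rec_nat prim_rec.intros)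
qed

lemma prim_rec_diff:
  assumes "prim_rec A" "prim_rec B" shows "prim_rec (\<lambda>e. A e - B e)"
proof -
  have p: "prim_rec (\<lambda>e. A e - 1)" if "prim_rec A" for A
  proof -
    have "n - 1 = rec_nat 0 (\<lambda>k r. k) n" for n :: nat by (induction n) auto
    then show ?thesis using that by (simp only:) (auto intro!: prim_rec_rec_nat prim_rec.intros)
  qed
  have "m - n = rec_nat m (\<lambda>k r. r - 1) n" for m n :: nat by (induction n) auto
  then have "(\<lambda>e. A e - B e) = (\<lambda>e. rec_nat (A e) (\<lambda>k r. r - 1) (B e))" by blast
  then show ?thesis using assms by (simp only:) (intro prim_rec_rec_nat prim_rec.intros p)
qed

lemma prim_rec_mult:
  assumes "prim_rec A" "prim_rec B" shows "prim_rec (\<lambda>e. A e * B e)"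
proof -
  have "m * n = rec_nat 0 (\<lambda>k r. r + m) n" for m n :: nat by (induction n) auto
  then show ?thesis using assms prim_rec_rename[OF assms(1), of "\<lambda>i. Suc (Suc i)"]
    by (simp only:) (intro prim_rec_rec_nat prim_rec.intros prim_rec_add)
qed

lemma prim_rec_power:
  assumes "prim_rec A" "prim_rec B" shows "prim_rec (\<lambda>e. A e ^ B e)"
proof -
  have "m ^ n = rec_nat 1 (\<lambda>k r. r * m) n" for m n :: nat by (induction n) auto
  then show ?thesis using assms prim_rec_rename[OF assms(1), of "\<lambda>i. Suc (Suc i)"]
    by (simp only:) (intro prim_rec_rec_nat prim_rec.intros prim_rec_mult prim_rec_const)
qed

lemma prim_rec_fact:
  assumes "prim_rec A" shows "prim_rec (\<lambda>e. fact (A e))"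
proof -
  have "fact n = rec_nat 1 (\<lambda>k r. r * Suc k) n" for n :: nat by (induction n) auto
  then show ?thesis using assms
    by (simp only:) (intro prim_rec_rec_nat prim_rec.intros prim_rec_mult prim_rec_const)
qed

lemma prim_rec_not:
  assumes "prim_rec (\<lambda>e. of_bool (P e))" shows "prim_rec (\<lambda>e. of_bool (\<not> P e))"
proof -
  have "of_bool (\<not> P e) = 1 - (of_bool (P e) :: nat)" for e by simp
  then show ?thesis using prim_rec_diff[OF prim_rec_const[of 1] assms] by (simp only:)
qed

lemma prim_rec_conj:
  assumes "prim_rec (\<lambda>e. of_bool (P e))" "prim_rec (\<lambda>e. of_bool (Q e))"
  shows "prim_rec (\<lambda>e. of_bool (P e \<and> Q e))"
  using prim_rec_mult[OF assms] by (simp add: of_bool_conj)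

lemma prim_rec_less:
  assumes "prim_rec A" "prim_rec B" shows "prim_rec (\<lambda>e. of_bool (A e < B e))"
proof -
  have "of_bool (m < n) = 1 - (1 - (n - m))" for m n :: nat by auto
  then show ?thesis using assms by (simp only:) (intro prim_rec_diff prim_rec_const)
qed

lemma prim_rec_le:
  assumes "prim_rec A" "prim_rec B" shows "prim_rec (\<lambda>e. of_bool (A e \<le> B e))"
  using prim_rec_not[OF prim_rec_less[OF assms(2,1)]] by (simp add: not_less)

lemma prim_rec_eq:
  assumes "prim_rec A" "prim_rec B" shows "prim_rec (\<lambda>e. of_bool (A e = B e))"
proof -
  have "of_bool (m = n) = (of_bool (m \<le> n \<and> n \<le> m) :: nat)" for m n :: nat by auto
  then show ?thesis using assms by (simp only:) (intro prim_rec_conj prim_rec_le)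
qed

lemma prim_rec_if:
  assumes "prim_rec (\<lambda>e. of_bool (P e))" "prim_rec A" "prim_rec B"
  shows "prim_rec (\<lambda>e. if P e then A e else B e)"
proof -
  have "(\<lambda>e. if P e then A e else B e) = (\<lambda>e. of_bool (P e) * A e + (1 - of_bool (P e)) * B e)"
    by auto
  then show ?thesis using assms by (simp only:) (intro prim_rec_add prim_rec_mult prim_rec_diff prim_rec_const)
qed

lemma prim_rec_sum:
  assumes "prim_rec (\<lambda>e. B (e 0) (\<lambda>i. e (Suc i)))" "prim_rec N"
  shows "prim_rec (\<lambda>e. \<Sum>k<N e. B k e)"
proof -
  have "(\<Sum>k<n. f k) = rec_nat 0 (\<lambda>k r. r + f k) n" for f :: "nat \<Rightarrow> nat" and n
    by (induction n) auto
  moreover have "prim_rec (\<lambda>e. B (e 0) (\<lambda>i. e (Suc (Suc i))))"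
    using prim_rec_rename[OF assms(1), of "case_nat 0 (\<lambda>i. Suc (Suc i))"] by simp
  ultimately show ?thesis using assms
    by (simp only:) (intro prim_rec_rec_nat prim_rec.intros prim_rec_add)
qed

text \<open>For positive \<open>n\<close> the quotient counts the \<open>q\<close> with
  \<open>Suc q * n \<le> m\<close>, and all of these lie below \<open>m\<close>, so a bounded sum
  suffices.\<close>

lemma prim_rec_div:
  assumes "prim_rec A" "prim_rec B" shows "prim_rec (\<lambda>e. A e div B e)"
proof -
  have "m div n = (if n = 0 then 0 else \<Sum>q<m. of_bool (Suc q * n \<le> m))" for m n :: nat
  proof (cases "n = 0")
    case False
    have "{q. q < m \<and> Suc q * n \<le> m} = {..<m div n}"
    proof -
      have "Suc q * n \<le> m \<longleftrightarrow> q < m div n" for q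
        using False less_eq_div_iff_mult_less_eq[of n "Suc q" m] by (simp add: Suc_le_eq)
      moreover have "m div n \<le> m" by simp
      ultimately show ?thesis by (auto intro: less_le_trans)
    qed
    moreover have "(\<Sum>q<m. of_bool (Suc q * n \<le> m)) = card {q. q < m \<and> Suc q * n \<le> m}"
      by (simp add: of_bool_def sum.If_cases Int_def del: mult_Suc)
    ultimately show ?thesis using False by simp
  qed simp
  then show ?thesis using assms prim_rec_rename[OF assms(1), of Suc] prim_rec_rename[OF assms(2), of Suc]
    by (simp only:) (intro prim_rec_if prim_rec_eq prim_rec_sum prim_rec_le prim_rec_mult prim_rec.intros)
qed

lemma prim_rec_mod:
  assumes "prim_rec A" "prim_rec B" shows "prim_rec (\<lambda>e. A e mod B e)"
  using assms by (simp add: modulo_nat_def prim_rec_diff prim_rec_mult prim_rec_div)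

lemma prim_rec_binomial:
  assumes "prim_rec A" "prim_rec B" shows "prim_rec (\<lambda>e. A e choose B e)"
proof -
  have "n choose k = (if k \<le> n then fact n div (fact k * fact (n - k)) else 0)" for n k :: nat
    using binomial_fact'[of k n] by (auto simp: binomial_eq_0)
  then show ?thesis using assms
    by (simp only:) (intro prim_rec_if prim_rec_le prim_rec_div prim_rec_mult prim_rec_diff prim_rec_fact prim_rec_const)
qed

lemma prim_rec_prod_encode:
  assumes "prim_rec A" "prim_rec B" shows "prim_rec (\<lambda>e. prod_encode (A e, B e))"
  unfolding prod_encode_def triangle_def using assms
  by simp (intro prim_rec_add prim_rec_div prim_rec_mult prim_rec.suc prim_rec_const)

text \<open>Both components of a pair are at most its code, so decoding is a search through a finite
  square. The search is written as a sum with one nonzero term, which is primitive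
  recursive.\<close>

lemma prod_decode_sum:
  "(\<Sum>a<Suc n. \<Sum>b<Suc n. if prod_encode (a, b) = n then h (a, b) else 0) = (h (prod_decode n) :: nat)"
proof -
  obtain a b where ab: "prod_decode n = (a, b)" by fastforce
  then have n: "prod_encode (a, b) = n" by (metis prod_decode_inverse)
  have "(\<Sum>a<Suc n. \<Sum>b<Suc n. if prod_encode (a, b) = n then h (a, b) else 0) =
    (\<Sum>p\<in>{..<Suc n} \<times> {..<Suc n}. if p = (a, b) then h p else 0)"
    unfolding sum.cartesian_product using n by (intro sum.cong) (auto simp: prod_encode_eq)
  also have "\<dots> = h (a, b)"
    using le_prod_encode_1[of a b] le_prod_encode_2[of b a] n by (auto simp: sum.delta less_Suc_eq_le)
  finally show ?thesis by (simp add: ab)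
qed

lemma prim_rec_fst_decode:
  assumes "prim_rec A" shows "prim_rec (\<lambda>e. fst (prod_decode (A e)))"
  unfolding prod_decode_sum[where h = fst, symmetric] fst_conv
  by (intro prim_rec_sum prim_rec_if prim_rec_eq prim_rec_prod_encode prim_rec.intros prim_rec_const
      assms prim_rec_rename[OF assms])

lemma prim_rec_snd_decode:
  assumes "prim_rec A" shows "prim_rec (\<lambda>e. snd (prod_decode (A e)))"
  unfolding prod_decode_sum[where h = snd, symmetric] snd_conv
  by (intro prim_rec_sum prim_rec_if prim_rec_eq prim_rec_prod_encode prim_rec.intros prim_rec_const
      assms prim_rec_rename[OF assms])

lemma prim_rec_odd:
  assumes "prim_rec A" shows "prim_rec (\<lambda>e. of_bool (odd (A e)))"
  using prim_rec_mod[OF assms prim_rec_const[of 2]] by (simp add: mod_2_eq_odd)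

lemmas prim_recI = prim_rec_const prim_rec.var prim_rec.suc prim_rec_add prim_rec_diff prim_rec_mult
  prim_rec_power prim_rec_not prim_rec_conj prim_rec_less prim_rec_le prim_rec_eq prim_rec_if
  prim_rec_sum prim_rec_div prim_rec_mod prim_rec_binomial prim_rec_prod_encode prim_rec_fst_decode
  prim_rec_snd_decode prim_rec_odd prim_rec_rec_nat

subsection \<open>Coded lists\<close>

text \<open>The empty list has code 0, and with truncated subtraction
  \<open>prod_decode (0 - 1)\<close> is \<open>(0, 0)\<close>. The formula thus yields the blank for
  the empty list, and the corresponding one for \<open>tl\<close> yields the empty list.\<close>

lemma scan_list_decode: "scan (list_decode c) = fst (prod_decode (c - 1))"
proof (cases c)
  case 0
  then show ?thesis by (simp add: scan_def prod_decode_def prod_decode_aux.simps)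
next
  case (Suc n)
  then show ?thesis by (auto simp: scan_def split: prod.split)
qed

lemma tl_list_decode: "tl (list_decode c) = list_decode (snd (prod_decode (c - 1)))"
proof (cases c)
  case 0
  then show ?thesis by (simp add: prod_decode_def prod_decode_aux.simps)
next
  case (Suc n)
  then show ?thesis by (auto split: prod.split)
qed

lemma drop_list_decode:
  "drop n (list_decode c) = list_decode (rec_nat c (\<lambda>k r. snd (prod_decode (r - 1))) n)"
proof (induction n)
  case (Suc n)
  have "drop (Suc n) (list_decode c) = tl (drop n (list_decode c))" by (simp add: drop_Suc tl_drop)
  then show ?case by (simp only: Suc tl_list_decode nat.rec)
qed simp

definition entry :: "nat \<Rightarrow> nat \<Rightarrow> nat" where
  "entry c i = scan (drop i (list_decode c))"

lemma entry_nth: "i < length (list_decode c) \<Longrightarrow> entry c i = list_decode c ! i"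
  by (simp add: entry_def scan_def Cons_nth_drop_Suc[symmetric])

lemma prim_rec_entry:
  assumes "prim_rec A" "prim_rec B" shows "prim_rec (\<lambda>e. entry (A e) (B e))"
proof (rule prim_rec_comp2[OF _ assms])
  show "prim_rec (\<lambda>e. entry (e 0) (e 1))"
    unfolding entry_def drop_list_decode scan_list_decode by (intro prim_recI)
qed

lemma length_list_decode_le: "length (list_decode c) \<le> c"
proof (induction c rule: less_induct)
  case (less c)
  show ?case
  proof (cases c)
    case (Suc n)
    obtain a b where ab: "prod_decode n = (a, b)" by fastforce
    then have "b \<le> n" using le_prod_encode_2[of b a] prod_decode_inverse[of n] by simp
    then show ?thesis using less[of b] Suc ab by simp
  qed simp
qed

text \<open>The iterated tail of a code is nonzero exactly as long as cells remain, and the length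
  is at most the code; counting nonzero tails below \<open>c\<close> gives the length.\<close>

lemma prim_rec_length:
  assumes "prim_rec A" shows "prim_rec (\<lambda>e. length (list_decode (A e)))"
proof (rule prim_rec_comp1[OF _ assms])
  have *: "length (list_decode c) = (\<Sum>i<c. of_bool (rec_nat c (\<lambda>k r. snd (prod_decode (r - 1))) i \<noteq> 0))" for c
  proof -
    let ?n = "length (list_decode c)"
    have nz: "rec_nat c (\<lambda>k r. snd (prod_decode (r - 1))) i \<noteq> 0 \<longleftrightarrow> i < ?n" for i
    proof -
      have "rec_nat c (\<lambda>k r. snd (prod_decode (r - 1))) i = list_encode (drop i (list_decode c))"
        by (simp add: drop_list_decode)
      also have "\<dots> = 0 \<longleftrightarrow> drop i (list_decode c) = []"
        by (cases "drop i (list_decode c)") auto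
      finally show ?thesis by auto
    qed
    have "(\<Sum>i<c. of_bool (i < ?n)) = card {i. i < c \<and> i < ?n}"
      by (simp add: of_bool_def sum.If_cases Int_def)
    also have "{i. i < c \<and> i < ?n} = {..<?n}" using length_list_decode_le[of c] by auto
    finally show ?thesis unfolding nz by simp
  qed
  show "prim_rec (\<lambda>e. length (list_decode (e 0)))"
    unfolding * by (intro prim_recI)
qed

lemma prim_rec_list_encode_map:
  assumes "prim_rec (\<lambda>e. B (e 0) (\<lambda>i. e (Suc i)))" "prim_rec N"
  shows "prim_rec (\<lambda>e. list_encode (map (\<lambda>k. B k e) [0..<N e]))"
proof -
  \<comment> \<open>The list is built from its right end: round \<open>j\<close> prepends the value
    at \<open>n - Suc j\<close>.\<close>
  have "rec_nat 0 (\<lambda>j r. Suc (prod_encode (f (n - Suc j), r))) m = list_encode (map f [n - m..<n])"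
    if "m \<le> n" for f n m
    using that
  proof (induction m)
    case (Suc m)
    then have "[n - Suc m..<n] = (n - Suc m) # [n - m..<n]"
      using upt_conv_Cons[of "n - Suc m" n] by (simp add: Suc_diff_Suc)
    then show ?case using Suc by simp
  qed simp
  from this[of n n for n] have *: "list_encode (map f [0..<n]) = rec_nat 0 (\<lambda>j r. Suc (prod_encode (f (n - Suc j), r))) n" for f n
    by simp
  have "prim_rec (\<lambda>e. B (N (\<lambda>i. e (Suc (Suc i))) - Suc (e 0)) (\<lambda>i. e (Suc (Suc i))))"
  proof -
    have "prim_rec (\<lambda>e. N (\<lambda>i. e (Suc (Suc i))) - Suc (e 0))"
      using prim_rec_rename[OF assms(2), of "\<lambda>i. Suc (Suc i)"] by (intro prim_recI)
    then have "prim_rec (case_nat (\<lambda>e. N (\<lambda>i. e (Suc (Suc i))) - Suc (e 0)) (\<lambda>i e. e (Suc (Suc i))) i)" for i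
      by (cases i) (simp_all add: prim_rec.var)
    from prim_rec_subst[where G = "case_nat (\<lambda>e. N (\<lambda>i. e (Suc (Suc i))) - Suc (e 0)) (\<lambda>i e. e (Suc (Suc i)))", OF assms(1) this]
    show ?thesis by simp
  qed
  then show ?thesis unfolding * using assms(2)
    by (intro prim_rec_rec_nat prim_recI)
qed

section \<open>Simulating Turing machines\<close>

abbreviation pfst :: "nat \<Rightarrow> nat" where "pfst c \<equiv> fst (prod_decode c)"
abbreviation psnd :: "nat \<Rightarrow> nat" where "psnd c \<equiv> snd (prod_decode c)"
abbreviation code_cons :: "nat \<Rightarrow> nat \<Rightarrow> nat" where "code_cons x c \<equiv> Suc (prod_encode (x, c))"
abbreviation code_hd :: "nat \<Rightarrow> nat" where "code_hd c \<equiv> pfst (c - 1)"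
abbreviation code_tl :: "nat \<Rightarrow> nat" where "code_tl c \<equiv> psnd (c - 1)"

definition dir_code :: "dir \<Rightarrow> nat" where
  "dir_code d = (case d of Go_Left \<Rightarrow> 0 | Stay \<Rightarrow> 1 | Go_Right \<Rightarrow> 2)"

definition action_code :: "nat \<times> dir \<Rightarrow> nat" where
  "action_code a = prod_encode (fst a, dir_code (snd a))"

definition key_code :: "nat \<times> nat list \<Rightarrow> nat" where
  "key_code x = prod_encode (fst x, list_encode (snd x))"

definition value_code :: "nat \<times> (nat \<times> dir) list \<Rightarrow> nat" where
  "value_code x = prod_encode (fst x, list_encode (map action_code (snd x)))"

definition tape_code :: "tape \<Rightarrow> nat" where
  "tape_code T = prod_encode (list_encode (fst T), list_encode (snd T))"

definition config_code :: "tm_config \<Rightarrow> nat" where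
  "config_code c = prod_encode (fst c, list_encode (map tape_code (snd c)))"

definition tm_code :: "nat \<Rightarrow> tm \<Rightarrow> nat" where
  "tm_code k M = prod_encode (k, list_encode (map (\<lambda>x. prod_encode (key_code (fst x), value_code (snd x))) M))"

definition code_act :: "nat \<Rightarrow> nat \<Rightarrow> nat" where
  "code_act a T =
    (if psnd a = 0 then prod_encode (code_tl (pfst T), code_cons (code_hd (pfst T)) (code_cons (pfst a) (code_tl (psnd T))))
     else if psnd a = 1 then prod_encode (pfst T, code_cons (pfst a) (code_tl (psnd T)))
     else prod_encode (code_cons (pfst a) (pfst T), code_tl (psnd T)))"

text \<open>A result of \<open>0\<close> means that no entry matches.\<close>

definition code_lookup :: "nat \<Rightarrow> nat \<Rightarrow> nat" where
  "code_lookup tab key = rec_nat 0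
     (\<lambda>i r. if r = 0 then (if pfst (entry tab i) = key then Suc (psnd (entry tab i)) else 0) else r)
     (length (list_decode tab))"

definition code_rule :: "nat \<Rightarrow> nat \<Rightarrow> nat" where
  "code_rule e c = code_lookup (psnd e)
     (prod_encode (pfst c, list_encode (map (\<lambda>i. code_hd (psnd (entry (psnd c) i))) [0..<pfst e])))"

definition code_step :: "nat \<Rightarrow> nat \<Rightarrow> nat" where
  "code_step e c = (if code_rule e c = 0 then c else
     prod_encode (pfst (code_rule e c - 1),
       list_encode (map (\<lambda>i. code_act (entry (psnd (code_rule e c - 1)) i) (entry (psnd c) i)) [0..<pfst e])))"

definition code_init :: "nat \<Rightarrow> nat \<Rightarrow> nat" where
  "code_init e n = prod_encode (0, list_encode (map (\<lambda>i. if i = 0 then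
     prod_encode (0, list_encode (map (\<lambda>_. 1) [0..<n])) else prod_encode (0, 0)) [0..<pfst e]))"

text \<open>The counter \<open>m\<close> keeps up with the position \<open>i\<close> only while all
  earlier entries are 1; after the first other symbol it stays frozen.\<close>

definition ones_prefix :: "nat \<Rightarrow> nat" where
  "ones_prefix c = rec_nat 0 (\<lambda>i m. if m = i \<and> entry c i = 1 then Suc m else m) (length (list_decode c))"

definition code_run :: "nat \<Rightarrow> nat \<Rightarrow> nat \<Rightarrow> nat" where
  "code_run e n t = rec_nat (code_init e n) (\<lambda>_ c. code_step e c) t"

text \<open>A universal function with a clock: 0 while the machine still runs after \<open>t\<close>
  steps, otherwise the successor of its output. It is total for every number \<open>e\<close>, also
  for those that code no machine.\<close>

definition sim :: "nat \<Rightarrow> nat \<Rightarrow> nat \<Rightarrow> nat" where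
  "sim e n t = (if code_rule e (code_run e n t) = 0
     then Suc (ones_prefix (psnd (entry (psnd (code_run e n t)) 0))) else 0)"

lemma prim_rec_code_act: "prim_rec A \<Longrightarrow> prim_rec B \<Longrightarrow> prim_rec (\<lambda>e. code_act (A e) (B e))"
  by (rule prim_rec_comp2[of code_act]) (unfold code_act_def, intro prim_recI)

lemma prim_rec_code_lookup: "prim_rec A \<Longrightarrow> prim_rec B \<Longrightarrow> prim_rec (\<lambda>e. code_lookup (A e) (B e))"
  by (rule prim_rec_comp2[of code_lookup])
    (unfold code_lookup_def, intro prim_recI prim_rec_entry prim_rec_length)

lemma prim_rec_code_rule: "prim_rec A \<Longrightarrow> prim_rec B \<Longrightarrow> prim_rec (\<lambda>e. code_rule (A e) (B e))"
  by (rule prim_rec_comp2[of code_rule])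
    (unfold code_rule_def, intro prim_recI prim_rec_entry prim_rec_code_lookup prim_rec_list_encode_map)

lemma prim_rec_code_step: "prim_rec A \<Longrightarrow> prim_rec B \<Longrightarrow> prim_rec (\<lambda>e. code_step (A e) (B e))"
  by (rule prim_rec_comp2[of code_step])
    (unfold code_step_def, intro prim_recI prim_rec_entry prim_rec_code_rule prim_rec_code_act prim_rec_list_encode_map)

lemma prim_rec_ones_prefix: "prim_rec A \<Longrightarrow> prim_rec (\<lambda>e. ones_prefix (A e))"
  by (rule prim_rec_comp1[of ones_prefix])
    (unfold ones_prefix_def, intro prim_recI prim_rec_entry prim_rec_length)

lemma prim_rec_code_run:
  "prim_rec A \<Longrightarrow> prim_rec B \<Longrightarrow> prim_rec C \<Longrightarrow> prim_rec (\<lambda>e. code_run (A e) (B e) (C e))"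
  by (rule prim_rec_comp3[of code_run])
    (unfold code_run_def code_init_def, intro prim_recI prim_rec_code_step prim_rec_list_encode_map)

lemma prim_rec_sim:
  "prim_rec A \<Longrightarrow> prim_rec B \<Longrightarrow> prim_rec C \<Longrightarrow> prim_rec (\<lambda>e. sim (A e) (B e) (C e))"
  by (rule prim_rec_comp3[of sim])
    (unfold sim_def, intro prim_recI prim_rec_entry prim_rec_code_rule prim_rec_code_run prim_rec_ones_prefix)

section \<open>Correctness of the coded simulation\<close>

lemma scan_code: "code_hd (list_encode xs) = scan xs"
  using scan_list_decode[of "list_encode xs"] by simp

lemma tl_code: "code_tl (list_encode xs) = list_encode (tl xs)"
  using tl_list_decode[of "list_encode xs"] by simp

lemma code_act: "code_act (action_code a) (tape_code T) = tape_code (act a T)"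
  using scan_code tl_code
  by (cases a; cases T; cases "snd a")
    (auto simp: code_act_def action_code_def tape_code_def act_def dir_code_def)

lemma entry_encode: "i < length xs \<Longrightarrow> entry (list_encode xs) i = xs ! i"
  by (simp add: entry_nth)

lemma key_code_inj: "key_code x = key_code y \<longleftrightarrow> x = y"
  by (auto simp: key_code_def prod_encode_eq prod_eq_iff list_encode_eq)

text \<open>Like \<open>map_of\<close>, the recursion keeps the first match, because a nonzero
  result is never overwritten. The proof compares both on prefixes of the table.\<close>

lemma code_lookup:
  "code_lookup (list_encode (map (\<lambda>x. prod_encode (key_code (fst x), value_code (snd x))) M)) (key_code key) =
     (case map_of M key of None \<Rightarrow> 0 | Some v \<Rightarrow> Suc (value_code v))"
proof -
  let ?tab = "list_encode (map (\<lambda>x. prod_encode (key_code (fst x), value_code (snd x))) M)"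
  have "rec_nat 0 (\<lambda>i r. if r = 0 then (if pfst (entry ?tab i) = key_code key then Suc (psnd (entry ?tab i)) else 0) else r) n
    = (case map_of (take n M) key of None \<Rightarrow> 0 | Some v \<Rightarrow> Suc (value_code v))" if "n \<le> length M" for n
    using that
  proof (induction n)
    case (Suc n)
    then have n: "n < length M" by simp
    then have "entry ?tab n = prod_encode (key_code (fst (M ! n)), value_code (snd (M ! n)))"
      by (simp add: entry_encode)
    then show ?case using Suc n
      by (auto simp: take_Suc_conv_app_nth map_add_def key_code_inj split: option.split)
  qed simp
  from this[of "length M"] show ?thesis by (simp add: code_lookup_def)
qed

lemma config_code_simps:
  "pfst (config_code (q, Ts)) = q" "psnd (config_code (q, Ts)) = list_encode (map tape_code Ts)"
  by (simp_all add: config_code_def)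

lemma code_rule:
  assumes "length Ts = k"
  shows "code_rule (tm_code k M) (config_code (q, Ts)) =
    (case map_of M (q, map (\<lambda>T. scan (snd T)) Ts) of None \<Rightarrow> 0 | Some v \<Rightarrow> Suc (value_code v))"
proof -
  have "map (\<lambda>i. code_hd (psnd (entry (list_encode (map tape_code Ts)) i))) [0..<k] = map (\<lambda>T. scan (snd T)) Ts"
    using assms scan_code by (intro nth_equalityI) (auto simp: entry_encode tape_code_def)
  then have "prod_encode (q, list_encode (map (\<lambda>i. code_hd (psnd (entry (list_encode (map tape_code Ts)) i))) [0..<k]))
    = key_code (q, map (\<lambda>T. scan (snd T)) Ts)"
    by (simp add: key_code_def)
  then show ?thesis
    unfolding code_rule_def config_code_simps by (simp add: tm_code_def code_lookup)
qed

definition next_config :: "tm \<Rightarrow> tm_config \<Rightarrow> tm_config" where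
  "next_config M c = (case tm_step M c of None \<Rightarrow> c | Some c' \<Rightarrow> c')"

lemma code_rule_halted:
  "length (snd c) = k \<Longrightarrow> code_rule (tm_code k M) (config_code c) = 0 \<longleftrightarrow> tm_step M c = None"
  by (cases c) (auto simp: code_rule tm_step_def split: option.split)

lemma code_step:
  assumes "wf_tm k M" "length (snd c) = k"
  shows "code_step (tm_code k M) (config_code c) = config_code (next_config M c)"
    and "length (snd (next_config M c)) = k"
proof -
  obtain q Ts where c: "c = (q, Ts)" and len: "length Ts = k" using assms(2) by (cases c) auto
  let ?key = "(q, map (\<lambda>T. scan (snd T)) Ts)"
  have "code_step (tm_code k M) (config_code c) = config_code (next_config M c) \<and>
    length (snd (next_config M c)) = k"
  proof (cases "map_of M ?key")
    case None
    then show ?thesis using len by (simp add: c code_step_def code_rule next_config_def tm_step_def)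
  next
    case (Some v)
    obtain q' as where v: "v = (q', as)" by fastforce
    have las: "length as = k"
      using map_of_SomeD[OF Some] assms(1) v by (auto simp: wf_tm_def)
    have "map (\<lambda>i. code_act (entry (list_encode (map action_code as)) i) (entry (list_encode (map tape_code Ts)) i)) [0..<k]
      = map tape_code (map2 act as Ts)"
      using las len by (intro nth_equalityI) (auto simp: entry_encode code_act)
    moreover have "next_config M c = (q', map2 act as Ts)"
      using Some by (simp add: c v next_config_def tm_step_def)
    moreover have "code_rule (tm_code k M) (config_code (q, Ts)) = Suc (value_code (q', as))"
      using len Some by (simp add: code_rule v)
    moreover have "pfst (tm_code k M) = k" by (simp add: tm_code_def)
    ultimately show ?thesis using las len
      unfolding code_step_def c config_code_simps
      by (simp add: value_code_def config_code_def[of "(q', _)"])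
  qed
  then show "code_step (tm_code k M) (config_code c) = config_code (next_config M c)"
    "length (snd (next_config M c)) = k" by auto
qed

lemma code_init:
  assumes "1 \<le> k" shows "code_init (tm_code k M) n = config_code (tm_init k n)"
proof -
  have "map (\<lambda>i. if i = 0 then prod_encode (0, list_encode (map (\<lambda>_. 1) [0..<n])) else prod_encode (0, 0)) [0..<k]
    = map tape_code (([], replicate n 1) # replicate (k - 1) ([], []))"
    using assms by (intro nth_equalityI) (auto simp: nth_Cons tape_code_def map_replicate_const split: nat.split)
  then show ?thesis by (simp add: code_init_def config_code_def tm_init_def tm_code_def)
qed

lemma ones_prefix: "ones_prefix (list_encode xs) = length (takeWhile (\<lambda>s. s = 1) xs)"
proof -
  have "rec_nat 0 (\<lambda>i m. if m = i \<and> entry (list_encode xs) i = 1 then Suc m else m) n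
     = length (takeWhile (\<lambda>s. s = 1) (take n xs))" if "n \<le> length xs" for n
    using that
  proof (induction n)
    case (Suc n)
    let ?ys = "take n xs"
    have len: "length ?ys = n" using Suc by simp
    have "length (takeWhile P ys) = length ys \<longleftrightarrow> (\<forall>s\<in>set ys. P s)" for P and ys :: "nat list"
      by (induction ys) auto
    from this[of _ ?ys] have "length (takeWhile (\<lambda>s. s = 1) ?ys) = n \<longleftrightarrow> (\<forall>s\<in>set ?ys. s = 1)"
      by (simp only: len)
    then show ?case using Suc
      by (auto simp: take_Suc_conv_app_nth entry_encode takeWhile_append)
  qed simp
  from this[of "length xs"] show ?thesis by (simp add: ones_prefix_def)
qed

text \<open>A halted configuration is a fixed point of \<open>next_config\<close>, so later clocks
  repeat the answer. The first property makes a requirement act eventually, the second makes its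
  action trustworthy.\<close>

theorem sim_complete:
  assumes "tm_computable f"
  obtains e where "\<And>n. \<exists>t0. \<forall>t\<ge>t0. sim e n t = Suc (f n)" "\<And>n t. sim e n t \<noteq> 0 \<Longrightarrow> sim e n t = Suc (f n)"
proof -
  obtain k M where wf: "wf_tm k M" and M: "tm_computes k M f"
    using assms by (auto simp: tm_computable_def)
  have k: "1 \<le> k" using wf by (simp add: wf_tm_def)
  let ?e = "tm_code k M"
  define C where "C n t = (next_config M ^^ t) (tm_init k n)" for n t
  have CSuc: "C n (Suc t) = next_config M (C n t)" for n t by (simp add: C_def)
  have run: "code_run ?e n t = config_code (C n t) \<and> length (snd (C n t)) = k" for n t
  proof (induction t)
    case 0
    then show ?case using code_init[OF k] k by (simp add: code_run_def C_def tm_init_def)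
  next
    case (Suc t)
    then show ?case using code_step[OF wf] by (simp add: code_run_def CSuc)
  qed
  have sim: "sim ?e n t = (if tm_step M (C n t) = None then Suc (tm_output (C n t)) else 0)" for n t
  proof -
    obtain q Ts where c: "C n t = (q, Ts)" by fastforce
    then have "length Ts = k" using run[of n t] by simp
    then obtain T Ts' where "Ts = T # Ts'" using k by (cases Ts) auto
    then have "psnd (entry (psnd (config_code (C n t))) 0) = list_encode (snd T)" "T = hd Ts"
      by (simp_all add: c config_code_simps entry_encode tape_code_def del: list_encode.simps)
    then show ?thesis using run[of n t]
      by (simp add: sim_def code_rule_halted ones_prefix tm_output_def c)
  qed
  have reachC: "\<exists>t. (next_config M ^^ t) a = b" if "reach M a b" for a b
    using that
  proof (induction rule: rtranclp_induct)
    case base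
    show ?case by (intro exI[of _ 0]) simp
  next
    case (step y z)
    then obtain t where "(next_config M ^^ t) a = y" by blast
    moreover have "next_config M y = z" using step(2) by (simp add: next_config_def)
    ultimately show ?case by (intro exI[of _ "Suc t"]) simp
  qed
  have stay: "C n t' = C n t" if "tm_step M (C n t) = None" "t \<le> t'" for n t t'
    using that(2)
  proof (induction rule: dec_induct)
    case (step m)
    then show ?case using that(1) by (simp add: CSuc next_config_def)
  qed simp
  have halts: "\<exists>t0. \<forall>t\<ge>t0. tm_step M (C n t) = None \<and> tm_output (C n t) = f n" for n
  proof -
    obtain c where c: "reach M (tm_init k n) c" "tm_step M c = None" "tm_output c = f n"
      using M unfolding tm_computes_def by blast
    then obtain t0 where "C n t0 = c" using reachC unfolding C_def by blast
    then show ?thesis using stay[of n t0] c by metis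
  qed
  have out: "tm_output (C n t) = f n" if "tm_step M (C n t) = None" for n t
    using stay[OF that] halts[of n] by (metis nat_le_linear)
  show ?thesis
  proof (rule that[of ?e])
    fix n
    obtain t0 where "\<And>t. t0 \<le> t \<Longrightarrow> tm_step M (C n t) = None \<and> tm_output (C n t) = f n"
      using halts[of n] by blast
    then show "\<exists>t0. \<forall>t\<ge>t0. sim ?e n t = Suc (f n)" by (intro exI[of _ t0]) (simp add: sim)
    show "sim ?e n t = Suc (f n)" if "sim ?e n t \<noteq> 0" for t
      using that out[of n t] by (simp add: sim split: if_splits)
  qed
qed

section \<open>A left-computable radius\<close>

text \<open>The radicand \<open>radicand s D\<close> is scaled by \<open>2 ^ s\<close>; \<open>D\<close> codes a finite set of
  requirements \<open>e\<close>, each contributing \<open>1 / 2 ^ e\<close>.\<close>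

definition radicand :: "nat \<Rightarrow> nat \<Rightarrow> nat" where
  "radicand s D = 10 * 2 ^ s + (\<Sum>e<s. of_bool (odd (D div 2 ^ e)) * 2 ^ (s - e))"

text \<open>The integer \<open>int_decode n\<close> has absolute value \<open>Suc n div 2\<close>;
  only squares of coordinates enter the norm, so signs disappear and natural numbers
  suffice.\<close>

definition num_sq :: "nat \<Rightarrow> nat" where "num_sq a = (Suc (pfst a) div 2) ^ 2"
definition den_sq :: "nat \<Rightarrow> nat" where "den_sq a = Suc (psnd a) ^ 2"

text \<open>The point coded by \<open>c\<close>, known up to \<open>1 / 2 ^ k\<close>, has squared norm below
  \<open>radicand s D / 2 ^ s + 1 / 2 ^ e\<close>. The constant 9 accounts for the error on points of norm
  at most 4.\<close>

definition certified :: "nat \<Rightarrow> nat \<Rightarrow> nat \<Rightarrow> nat \<Rightarrow> nat \<Rightarrow> bool" where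
  "certified c k e s D \<longleftrightarrow>
     (num_sq (pfst c) * den_sq (psnd c) + num_sq (psnd c) * den_sq (pfst c)) * 2 ^ k * 2 ^ s
       + 9 * (den_sq (pfst c) * den_sq (psnd c)) * 2 ^ s
     < (radicand s D + 2 ^ (s - e)) * (den_sq (pfst c) * den_sq (psnd c)) * 2 ^ k"

text \<open>Stage \<open>s\<close> codes a machine \<open>e\<close>, an input \<open>m = (n, k)\<close> and a number of steps \<open>t\<close>.\<close>

definition trigger :: "nat \<Rightarrow> nat \<Rightarrow> bool" where
  "trigger s D \<longleftrightarrow> \<not> odd (D div 2 ^ pfst s) \<and>
     \<not> sim (pfst s) (pfst (psnd s)) (psnd (psnd s)) = 0 \<and>
     certified (sim (pfst s) (pfst (psnd s)) (psnd (psnd s)) - 1) (psnd (pfst (psnd s))) (pfst s) s D"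

text \<open>The bits of the value are the requirements that have acted. Since \<open>trigger\<close>
  demands a clear bit, adding the power of two inserts exactly that bit, and no requirement acts
  twice.\<close>

definition acted :: "nat \<Rightarrow> nat" where
  "acted s = rec_nat 0 (\<lambda>s D. if trigger s D then D + 2 ^ pfst s else D) s"

definition numer :: "nat \<Rightarrow> nat" where "numer s = radicand s (acted s)"

lemma prim_rec_radicand: "prim_rec A \<Longrightarrow> prim_rec B \<Longrightarrow> prim_rec (\<lambda>e. radicand (A e) (B e))"
  by (rule prim_rec_comp2[of radicand]) (unfold radicand_def, intro prim_recI)

lemma prim_rec_num_sq: "prim_rec A \<Longrightarrow> prim_rec (\<lambda>e. num_sq (A e))"
  by (rule prim_rec_comp1[of num_sq]) (unfold num_sq_def, intro prim_recI)

lemma prim_rec_den_sq: "prim_rec A \<Longrightarrow> prim_rec (\<lambda>e. den_sq (A e))"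
  by (rule prim_rec_comp1[of den_sq]) (unfold den_sq_def, intro prim_recI)

lemma prim_rec_trigger: "prim_rec A \<Longrightarrow> prim_rec B \<Longrightarrow> prim_rec (\<lambda>e. of_bool (trigger (A e) (B e)))"
  by (rule prim_rec_comp2[of "\<lambda>s D. of_bool (trigger s D)"])
    (unfold trigger_def certified_def, intro prim_recI prim_rec_sim prim_rec_radicand prim_rec_num_sq prim_rec_den_sq)

lemma prim_rec_numer: "prim_rec A \<Longrightarrow> prim_rec (\<lambda>e. numer (A e))"
  by (rule prim_rec_comp1[of numer])
    (unfold numer_def acted_def, intro prim_recI prim_rec_trigger prim_rec_radicand)

lemma pfst_le: "pfst s \<le> s"
  using le_prod_encode_1[of "pfst s" "psnd s"] by simp

lemma odd_div_iff: "odd (D div 2 ^ e) \<longleftrightarrow> e \<in> set_decode D"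
  by (simp add: set_decode_def)

lemma acted_0: "set_decode (acted 0) = {}"
  by (simp add: acted_def)

lemma acted_Suc:
  "set_decode (acted (Suc s)) =
    (if trigger s (acted s) then insert (pfst s) (set_decode (acted s)) else set_decode (acted s))"
proof (cases "trigger s (acted s)")
  case True
  then have "pfst s \<notin> set_decode (acted s)" by (simp add: trigger_def odd_div_iff)
  then have "set_encode (insert (pfst s) (set_decode (acted s))) = acted (Suc s)"
    using True by (simp add: acted_def)
  then show ?thesis using True by (metis finite_set_decode finite_insert set_encode_inverse)
qed (simp add: acted_def)

text \<open>A requirement is a component of the stage that treats it, hence at most that stage
  number. Consequently \<open>2 ^ s\<close> is a common denominator for \<open>q s\<close>.\<close>

lemma acted_bound: "set_decode (acted s) \<subseteq> {..<s}"
proof (induction s)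
  case (Suc s)
  then show ?case using pfst_le[of s] by (auto simp: acted_Suc split: if_splits)
qed (simp add: acted_0)

section \<open>The rational approximations \<open>q\<close> and their limit \<open>Q\<close>\<close>

definition q :: "nat \<Rightarrow> real" where
  "q s = 10 + (\<Sum>e\<in>set_decode (acted s). 1 / 2 ^ e)"

lemma numer_q: "real (numer s) / 2 ^ s = q s"
proof -
  have "(\<Sum>e<s. of_bool (odd (acted s div 2 ^ e)) * 2 ^ (s - e)) = (\<Sum>e\<in>set_decode (acted s). (2::nat) ^ (s - e))"
    using acted_bound[of s]
    by (intro sum.mono_neutral_cong_right) (auto simp: odd_div_iff)
  then have "real (numer s) / 2 ^ s = 10 + (\<Sum>e\<in>set_decode (acted s). 2 ^ (s - e)) / 2 ^ s"
    by (simp add: numer_def radicand_def add_divide_distrib)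
  also have "(\<Sum>e\<in>set_decode (acted s). 2 ^ (s - e)) / 2 ^ s = (\<Sum>e\<in>set_decode (acted s). (1::real) / 2 ^ e)"
    unfolding sum_divide_distrib using acted_bound[of s]
    by (intro sum.cong) (auto simp: power_diff field_simps)
  finally show ?thesis by (simp add: q_def)
qed

lemma q_Suc: "q (Suc s) = (if trigger s (acted s) then q s + 1 / 2 ^ pfst s else q s)"
proof (cases "trigger s (acted s)")
  case True
  then have "pfst s \<notin> set_decode (acted s)" by (simp add: trigger_def odd_div_iff)
  then show ?thesis using True by (simp add: q_def acted_Suc)
qed (simp add: q_def acted_Suc)

lemma q_mono: "s \<le> s' \<Longrightarrow> q s \<le> q s'"
  by (rule lift_Suc_mono_le[of q]) (simp_all add: q_Suc)

lemma q_bounds: "10 \<le> q s" "q s \<le> 12"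
proof -
  show "10 \<le> q s" by (simp add: q_def sum_nonneg)
  have "(\<Sum>e\<in>set_decode (acted s). (1::real) / 2 ^ e) \<le> (\<Sum>e<s. 1 / 2 ^ e)"
    using acted_bound by (intro sum_mono2) auto
  also have "\<dots> = 2 - 2 / 2 ^ s" by (induction s) (auto simp: field_simps)
  also have "\<dots> \<le> 2" by simp
  finally show "q s \<le> 12" by (simp add: q_def)
qed

definition Q :: real where "Q = (SUP s. q s)"

lemma bdd_q: "bdd_above (range q)"
  using q_bounds by (intro bdd_aboveI2)

lemma q_le_Q: "q s \<le> Q"
  unfolding Q_def using bdd_q by (rule cSUP_upper2) auto

lemma Q_bounds: "10 \<le> Q" "Q \<le> 12"
proof -
  show "10 \<le> Q" using q_bounds(1)[of 0] q_le_Q[of 0] by linarith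
  show "Q \<le> 12" unfolding Q_def using q_bounds by (intro cSUP_least) auto
qed

lemma less_Q: "u < Q \<Longrightarrow> \<exists>s0. \<forall>s\<ge>s0. u < q s"
proof -
  assume "u < Q"
  then obtain s0 where "u < q s0" using less_cSUP_iff[OF _ bdd_q] by (auto simp: Q_def)
  then show ?thesis using q_mono by (meson less_le_trans)
qed

lemma rat_of_code_sq: "rat_of_code a ^ 2 = real (num_sq a) / real (den_sq a)"
proof -
  have *: "\<bar>int_decode n\<bar> = int (Suc n div 2)" for n
    by (auto simp: int_decode_def sum_decode_def elim!: oddE evenE)
  have "real_of_int (int_decode (pfst a)) ^ 2 = real_of_int (\<bar>int_decode (pfst a)\<bar> ^ 2)" by simp
  also have "\<dots> = real (num_sq a)" unfolding * by (simp add: num_sq_def)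
  finally show ?thesis
    by (simp add: rat_of_code_def case_prod_unfold power_divide den_sq_def)
qed

lemma norm_point_of_code_sq:
  "norm (point_of_code c) ^ 2 = real (num_sq (pfst c)) / real (den_sq (pfst c)) + real (num_sq (psnd c)) / real (den_sq (psnd c))"
  by (simp add: point_of_code_def case_prod_unfold norm_prod_def rat_of_code_sq)

text \<open>All denominators have been cleared in \<open>certified\<close>; the hypothesis
  \<open>e \<le> s\<close> makes the truncated exponent \<open>s - e\<close> exact.\<close>

lemma certified_iff:
  assumes "e \<le> s"
  shows "certified c k e s D \<longleftrightarrow>
    norm (point_of_code c) ^ 2 + 9 / 2 ^ k < real (radicand s D) / 2 ^ s + 1 / 2 ^ e"
proof -
  define A B X Y K S where "A = real (num_sq (pfst c))" and "B = real (num_sq (psnd c))"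
    and "X = real (den_sq (pfst c))" and "Y = real (den_sq (psnd c))"
    and "K = (2::real) ^ k" and "S = (2::real) ^ s"
  define N where "N = real (radicand s D)"
  have pos: "X > 0" "Y > 0" "K > 0" "S > 0" by (auto simp: X_def Y_def K_def S_def den_sq_def)
  have se: "(2::real) ^ (s - e) = S / 2 ^ e" using assms by (simp add: S_def power_diff)
  have "certified c k e s D \<longleftrightarrow> (A * Y + B * X) * K * S + 9 * (X * Y) * S < (N + 2 ^ (s - e)) * (X * Y) * K"
    unfolding certified_def A_def B_def X_def Y_def K_def S_def N_def
    by (simp flip: of_nat_less_iff[where 'a = real])
  also have "\<dots> \<longleftrightarrow> ((A * Y + B * X) * K * S + 9 * (X * Y) * S) / (X * Y * K * S) < ((N + S / 2 ^ e) * (X * Y) * K) / (X * Y * K * S)"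
  proof -
    have "0 < X * Y * K * S" using pos by simp
    then show ?thesis unfolding se divide_less_cancel by auto
  qed
  also have "((A * Y + B * X) * K * S + 9 * (X * Y) * S) / (X * Y * K * S) = A / X + B / Y + 9 / K"
    using pos by (simp add: field_simps)
  also have "((N + S / 2 ^ e) * (X * Y) * K) / (X * Y * K * S) = N / S + 1 / 2 ^ e"
    using pos by (simp add: field_simps)
  finally show ?thesis by (simp add: norm_point_of_code_sq A_def B_def X_def Y_def K_def S_def N_def)
qed

lemma norm_sq_perturb:
  fixes x y :: "'a::real_normed_vector"
  assumes "dist x y \<le> d" "d \<le> 1" "norm x \<le> 4"
  shows "norm y ^ 2 \<le> norm x ^ 2 + 9 * d"
proof -
  have d: "0 \<le> d" using assms(1) zero_le_dist by (rule order_trans[rotated])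
  have "norm y \<le> norm x + d" using assms(1) norm_triangle_sub[of y x] by (simp add: dist_norm norm_minus_commute)
  then have "norm y ^ 2 \<le> (norm x + d) ^ 2" by (intro power_mono) auto
  also have "\<dots> = norm x ^ 2 + 2 * norm x * d + d * d" by (simp add: power2_eq_square algebra_simps)
  also have "\<dots> \<le> norm x ^ 2 + 8 * d + d"
    using mult_right_mono[OF assms(3) d] mult_right_mono[OF assms(2) d] by linarith
  finally show ?thesis by simp
qed

text \<open>Let \<open>e\<close> code the machine of an alleged dense sequence. If \<open>e\<close>
  acted, the certificate with its error margin would put the true point \<open>x n\<close> inside
  the disc; so \<open>e\<close> never acts. But some \<open>x n\<close> lies close to the critical
  circle, and a precise approximation of it, examined at a late stage, does trigger
  \<open>e\<close>.\<close>

theorem not_computable_disc: "\<not> computable_open_set {z. norm z ^ 2 < Q}"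
proof
  let ?W = "{z :: real \<times> real. norm z ^ 2 < Q}"
  assume "computable_open_set ?W"
  define z0 where "z0 = (sqrt Q, 0 :: real)"
  have z0: "norm z0 ^ 2 = Q" using Q_bounds by (simp add: z0_def norm_prod_def)
  then have "z0 \<in> - ?W" by simp
  then have "- ?W \<noteq> {}" by blast
  then obtain x where x: "computable_point_seq x" "range x \<subseteq> - ?W" "- ?W \<subseteq> closure (range x)"
    using \<open>computable_open_set ?W\<close> unfolding computable_open_set_def by blast
  then obtain f where f: "tm_computable f"
    and fx: "\<And>n k. dist (point_of_code (f (prod_encode (n, k)))) (x n) \<le> 1 / 2 ^ k"
    by (auto simp: computable_point_seq_def)
  obtain e where e: "\<And>n. \<exists>t0. \<forall>t\<ge>t0. sim e n t = Suc (f n)" "\<And>n t. sim e n t \<noteq> 0 \<Longrightarrow> sim e n t = Suc (f n)"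
    using sim_complete[OF f] by metis
  have outside: "Q \<le> norm (x n) ^ 2" for n using subsetD[OF x(2) rangeI[of x n]] by (simp add: not_less)
  have never: "e \<notin> set_decode (acted s)" for s
  proof (induction s)
    case 0
    then show ?case by (simp add: acted_0)
  next
    case (Suc s)
    have False if tr: "trigger s (acted s)" and es: "pfst s = e"
    proof -
      let ?m = "pfst (psnd s)"
      define n where "n = pfst ?m"
      define k where "k = psnd ?m"
      let ?z = "point_of_code (f ?m)"
      have m: "?m = prod_encode (n, k)" by (simp add: n_def k_def)
      have "e \<le> s" using pfst_le[of s] es by simp
      have "sim e ?m (psnd (psnd s)) = Suc (f ?m)" using tr es e(2) by (auto simp: trigger_def)
      then have "certified (f ?m) k e s (acted s)" using tr es by (simp add: trigger_def k_def)
      then have c: "norm ?z ^ 2 + 9 / 2 ^ k < q s + 1 / 2 ^ e"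
        using \<open>e \<le> s\<close> numer_q[of s] by (simp add: certified_iff numer_def)
      also have e1: "q s + 1 / 2 ^ e = q (Suc s)" using tr es by (simp add: q_Suc)
      finally have c': "norm ?z ^ 2 + 9 / 2 ^ k < q (Suc s)" .
      have "0 < 9 / (2::real) ^ k" by simp
      then have "norm ?z ^ 2 < 16" using c' q_bounds(2)[of "Suc s"] by linarith
      then have "norm ?z ^ 2 < 4 ^ 2" by simp
      then have "norm ?z \<le> 4" by (meson less_imp_le power_less_imp_less_base zero_le_numeral)
      then have "norm (x n) ^ 2 \<le> norm ?z ^ 2 + 9 * (1 / 2 ^ k)"
        using fx[of n k] m by (intro norm_sq_perturb) auto
      then show False using c' q_le_Q[of "Suc s"] outside[of n] by simp
    qed
    then show ?case using Suc by (auto simp: acted_Suc)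
  qed
  define \<epsilon> where "\<epsilon> = 1 / (2::real) ^ e"
  have \<epsilon>: "0 < \<epsilon>" "\<epsilon> \<le> 1" by (auto simp: \<epsilon>_def)
  let ?O = "{z :: real \<times> real. norm z ^ 2 < Q + \<epsilon> / 4}"
  have "open ?O" by (intro open_Collect_less continuous_intros)
  moreover have "z0 \<in> ?O" using z0 \<epsilon> by simp
  moreover have "z0 \<in> closure (range x)" using x(3) \<open>z0 \<in> - ?W\<close> by blast
  ultimately obtain n where n: "norm (x n) ^ 2 < Q + \<epsilon> / 4"
    using open_Int_closure_eq_empty[of ?O "range x"] by auto
  \<comment> \<open>The budget is \<open>\<epsilon>\<close>: at most a quarter for
    \<open>x n\<close> beyond \<open>Q\<close>, a quarter for \<open>Q\<close> beyond
    \<open>q s\<close>, and two errors \<open>9 / 2 ^ k\<close>, each below an eighth, one from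
    approximating \<open>x n\<close> and one demanded by the certificate.\<close>
  obtain k where k: "(1 / 2) ^ k < \<epsilon> / 72"
    using real_arch_pow_inv[of "\<epsilon> / 72" "1 / 2"] \<epsilon> by auto
  obtain s0 where s0: "\<And>s. s0 \<le> s \<Longrightarrow> Q - \<epsilon> / 4 < q s" using less_Q[of "Q - \<epsilon> / 4"] \<epsilon> by auto
  define m where "m = prod_encode (n, k)"
  obtain t0 where t0: "\<And>t. t0 \<le> t \<Longrightarrow> sim e m t = Suc (f m)" using e(1)[of m] by blast
  define t where "t = max t0 s0"
  \<comment> \<open>Pairing dominates its components, so a large clock \<open>t\<close> also makes
    the stage late.\<close>
  define s where "s = prod_encode (e, prod_encode (m, t))"
  have s: "pfst s = e" "pfst (psnd s) = m" "psnd (psnd s) = t" "e \<le> s" "s0 \<le> s"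
  proof -
    have "t \<le> prod_encode (m, t)" "prod_encode (m, t) \<le> s" by (auto simp: s_def le_prod_encode_2)
    then show "s0 \<le> s" by (simp add: t_def)
  qed (auto simp: s_def le_prod_encode_1)
  let ?z = "point_of_code (f m)"
  have "norm (x n) ^ 2 < 4 ^ 2" using n \<epsilon> Q_bounds by simp
  then have "norm (x n) \<le> 4" by (meson less_imp_le power_less_imp_less_base zero_le_numeral)
  then have "norm ?z ^ 2 \<le> norm (x n) ^ 2 + 9 * (1 / 2 ^ k)"
    using fx[of n k] by (intro norm_sq_perturb) (auto simp: m_def dist_commute)
  moreover have "1 / 2 ^ k < \<epsilon> / 72" using k by (simp add: power_one_over)
  moreover have "9 / 2 ^ k = 9 * (1 / (2::real) ^ k)" by simp
  ultimately have "norm ?z ^ 2 + 9 / 2 ^ k < q s + \<epsilon>"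
    using n s0[OF s(5)] \<epsilon>(1) by linarith
  then have "norm ?z ^ 2 + 9 / 2 ^ k < q s + 1 / 2 ^ e" by (simp only: \<epsilon>_def)
  then have "certified (f m) k e s (acted s)"
    using s(4) numer_q[of s] by (simp add: certified_iff numer_def)
  moreover have "sim e m t = Suc (f m)" using t0[of t] by (simp add: t_def)
  ultimately have "trigger s (acted s)"
    using never[of s] s by (simp add: trigger_def odd_div_iff m_def)
  then have "e \<in> set_decode (acted (Suc s))" by (simp add: acted_Suc s)
  then show False using never by blast
qed

section \<open>Smooth functions\<close>

lemma C_k_Suc_imp: "C_k (Suc n) f \<Longrightarrow> C_k n f"
proof (induction n arbitrary: f)
  case 0
  then show ?case
    by (auto intro!: continuous_at_imp_continuous_on differentiable_imp_continuous_within)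
next
  case (Suc n)
  then show ?case by (metis C_k.simps(2))
qed

lemma C_k_SucI:
  assumes "\<And>x. (f has_derivative f' x) (at x)" "\<And>v. C_k n (\<lambda>x. f' x v)"
  shows "C_k (Suc n) f"
proof -
  have "frechet_derivative f (at x) = f' x" for x
    using frechet_derivative_at[OF assms(1)] by simp
  then show ?thesis using assms by (auto simp: differentiable_def)
qed

lemma C_k_SucD:
  assumes "C_k (Suc n) f"
  shows "(f has_derivative frechet_derivative f (at x)) (at x)"
    and "C_k n (\<lambda>x. frechet_derivative f (at x) v)"
  using assms by (simp_all add: frechet_derivative_works[symmetric])

lemma C_k_const: "C_k n (\<lambda>x. c)"
proof (induction n arbitrary: c)
  case (Suc n)
  show ?case by (rule C_k_SucI[where f' = "\<lambda>_ _. 0"]) (auto intro: Suc)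
qed simp

lemma C_k_bounded_linear: "bounded_linear f \<Longrightarrow> C_k n f"
proof (cases n)
  case (Suc m)
  assume "bounded_linear f"
  then show ?thesis unfolding Suc
    by (intro C_k_SucI[where f' = "\<lambda>_. f"] bounded_linear_imp_has_derivative C_k_const)
qed (simp add: linear_continuous_on)

lemma C_k_add: "C_k n f \<Longrightarrow> C_k n g \<Longrightarrow> C_k n (\<lambda>x. f x + g x)"
proof (induction n arbitrary: f g)
  case (Suc n)
  show ?case
    by (rule C_k_SucI[OF has_derivative_add[OF C_k_SucD(1)[OF Suc.prems(1)] C_k_SucD(1)[OF Suc.prems(2)]]])
      (intro Suc.IH Suc.prems[THEN C_k_SucD(2)])
qed (simp add: continuous_on_add)

lemma C_k_scaleR: "C_k n f \<Longrightarrow> C_k n g \<Longrightarrow> C_k n (\<lambda>x. f x *\<^sub>R g x)"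
proof (induction n arbitrary: f g)
  case (Suc n)
  show ?case
    by (rule C_k_SucI[OF has_derivative_scaleR[OF C_k_SucD(1)[OF Suc.prems(1)] C_k_SucD(1)[OF Suc.prems(2)]]])
      (intro C_k_add Suc.IH Suc.prems[THEN C_k_SucD(2)] Suc.prems[THEN C_k_Suc_imp])
qed (simp add: continuous_on_scaleR)

text \<open>The family \<open>f\<close> is closed under differentiation, with \<open>d\<close>
  sending an index to that of the derivative. One application of the chain rule then returns to the
  same family times a linear function, and induction over all indices replaces a higher-order chain
  rule.\<close>

lemma C_k_comp_norm_sq:
  fixes f :: "'i \<Rightarrow> real \<Rightarrow> real"
  assumes "\<And>i u. (f i has_real_derivative f (d i) u) (at u)"
  shows "C_k n (\<lambda>z :: 'a::real_inner. f i (z \<bullet> z))"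
proof (induction n arbitrary: i)
  case 0
  have "continuous_on UNIV (f i)"
    using assms DERIV_isCont by (blast intro: continuous_at_imp_continuous_on)
  then show ?case by (auto intro!: continuous_intros intro: continuous_on_compose2)
next
  case (Suc n)
  show ?case
  proof (rule C_k_SucI)
    fix z :: 'a
    have "((\<lambda>z :: 'a. z \<bullet> z) has_derivative (\<lambda>v. 2 * (z \<bullet> v))) (at z)"
      by (auto intro!: derivative_eq_intros simp: inner_commute)
    from DERIV_compose_FDERIV[OF assms this]
    show "((\<lambda>z :: 'a. f i (z \<bullet> z)) has_derivative (\<lambda>v. f (d i) (z \<bullet> z) *\<^sub>R (2 * (z \<bullet> v)))) (at z)"
      by (simp add: mult.commute)
    fix v :: 'a
    have "bounded_linear (\<lambda>z. 2 * (z \<bullet> v))"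
      by (intro bounded_linear_const_mult bounded_linear_inner_left)
    then show "C_k n (\<lambda>z. f (d i) (z \<bullet> z) *\<^sub>R (2 * (z \<bullet> v)))"
      by (intro C_k_scaleR Suc C_k_bounded_linear)
  qed
qed

text \<open>The domain is finite-dimensional, so continuity of the directional derivatives gives
  continuity of the derivative in the operator norm.\<close>

lemma C1_on_restrict:
  fixes h :: "'a::euclidean_space \<Rightarrow> 'b::real_normed_vector"
  assumes "C_k 1 h"
  shows "C1_on S (restrict h S)"
proof -
  have "C_k (Suc 0) h" using assms by simp
  note d = C_k_SucD[OF this]
  define f' where "f' = (\<lambda>x. Blinfun (frechet_derivative h (at x)))"
  have f': "blinfun_apply (f' x) = frechet_derivative h (at x)" for x
    unfolding f'_def using has_derivative_bounded_linear[OF d(1)] by (rule bounded_linear_Blinfun_apply)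
  have "(restrict h S has_derivative blinfun_apply (f' x)) (at x within S)" if "x \<in> S" for x
    unfolding f'
    by (rule has_derivative_transform[OF that _ has_derivative_at_withinI[OF d(1)]]) simp
  moreover have "continuous_on S f'"
    using d(2) by (intro continuous_on_blinfun_componentwise) (auto simp: f' intro: continuous_on_subset)
  ultimately show ?thesis unfolding C1_on_def by blast
qed

section \<open>A flat function\<close>

text \<open>The classical flat function is the case \<open>p = 1\<close>. Polynomial factors in
  \<open>1 / v\<close> are carried along so that the family is closed under differentiation.\<close>

definition flat :: "real poly \<Rightarrow> real \<Rightarrow> real" where
  "flat p v = (if v \<le> 0 then 0 else poly p (1 / v) * exp (- 1 / v))"

text \<open>The quotient \<open>w ^ k / fact k\<close> is a single term of the exponential
  series.\<close>

lemma power_le_exp: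
  fixes w :: real
  assumes "0 \<le> w"
  shows "w ^ k * exp (- w) \<le> fact k"
proof -
  have "(\<Sum>i\<in>{k}. w ^ i /\<^sub>R fact i) \<le> (\<Sum>i. w ^ i /\<^sub>R fact i)"
    using assms by (intro sum_le_suminf sums_summable[OF exp_converges]) auto
  then have "w ^ k / fact k \<le> exp w" using exp_converges[of w] by (simp add: sums_iff divide_inverse mult.commute)
  then have "w ^ k \<le> fact k * exp w" by (simp add: field_simps)
  then show ?thesis by (simp add: exp_minus field_simps)
qed

lemma flat_bound: "\<exists>C\<ge>0. \<forall>v. \<bar>flat p v\<bar> \<le> C"
proof -
  let ?C = "\<Sum>i\<le>degree p. \<bar>coeff p i\<bar> * fact i"
  have "\<bar>flat p v\<bar> \<le> ?C" for v
  proof (cases "v \<le> 0")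
    case False
    have "\<bar>flat p v\<bar> = \<bar>\<Sum>i\<le>degree p. coeff p i * ((1 / v) ^ i * exp (- (1 / v)))\<bar>"
      using False by (simp add: flat_def poly_altdef sum_distrib_right mult.assoc)
    also have "\<dots> \<le> (\<Sum>i\<le>degree p. \<bar>coeff p i\<bar> * ((1 / v) ^ i * exp (- (1 / v))))"
      using False by (intro order_trans[OF sum_abs]) (auto simp: abs_mult)
    also have "\<dots> \<le> ?C"
      using False by (intro sum_mono mult_left_mono power_le_exp) auto
    finally show ?thesis .
  qed (simp add: flat_def sum_nonneg)
  then show ?thesis by (intro exI[of _ ?C]) (simp add: sum_nonneg)
qed

text \<open>The factor \<open>1 / v ^ 2\<close> is absorbed into the polynomial, leaving a bounded
  flat function. The quadratic bound gives derivative 0 at the origin.\<close>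

lemma flat_bound_sq: "\<exists>C\<ge>0. \<forall>v. \<bar>flat p v\<bar> \<le> C * v\<^sup>2"
proof -
  obtain C where C: "0 \<le> C" "\<And>v. \<bar>flat (monom 1 2 * p) v\<bar> \<le> C" using flat_bound by blast
  have "\<bar>flat p v\<bar> \<le> C * v\<^sup>2" for v
  proof (cases "v \<le> 0")
    case False
    have "\<bar>flat p v\<bar> = \<bar>flat (monom 1 2 * p) v\<bar> * v\<^sup>2"
      using False by (simp add: flat_def poly_monom abs_mult power2_eq_square)
    then show ?thesis using C(2)[of v] by (simp add: mult_right_mono)
  qed (use C in \<open>simp add: flat_def\<close>)
  then show ?thesis using C by blast
qed

text \<open>With \<open>w = 1 / v\<close> one has \<open>dw / dv = - w ^ 2\<close>, so
  \<open>p(w) exp (- w)\<close> has derivative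
  \<open>w ^ 2 (p(w) - p'(w)) exp (- w)\<close>.\<close>

definition flat_deriv :: "real poly \<Rightarrow> real poly" where
  "flat_deriv p = monom 1 2 * (p - pderiv p)"

lemma flat_has_derivative: "(flat p has_real_derivative flat (flat_deriv p) v) (at v)"
proof -
  consider "v < 0" | "v = 0" | "v > 0" by linarith
  then show ?thesis
  proof cases
    case 1
    have "((\<lambda>v. 0) has_real_derivative 0) (at v)" by simp
    then have "(flat p has_real_derivative 0) (at v)"
      by (rule has_field_derivative_transform_within_open[of _ _ _ "{..<0}"]) (use 1 in \<open>auto simp: flat_def\<close>)
    then show ?thesis using 1 by (simp add: flat_def)
  next
    case 2
    obtain C where C: "0 \<le> C" "\<And>v. \<bar>flat p v\<bar> \<le> C * v\<^sup>2" using flat_bound_sq by blast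
    have "((\<lambda>h. flat p h / h) \<longlongrightarrow> 0) (at 0)"
    proof (rule Lim_null_comparison)
      have "norm (flat p h / h) \<le> C * \<bar>h\<bar>" if "h \<noteq> 0" for h
        using C(2)[of h] that by (simp add: divide_le_eq power2_eq_square abs_mult[symmetric] mult.assoc)
      then show "\<forall>\<^sub>F h in at 0. norm (flat p h / h) \<le> C * \<bar>h\<bar>"
        by (simp add: eventually_at_filter)
      show "((\<lambda>h. C * \<bar>h\<bar>) \<longlongrightarrow> 0) (at 0)" by (auto intro!: tendsto_eq_intros)
    qed
    then show ?thesis using 2 by (simp add: DERIV_def flat_def)
  next
    case 3
    have "((\<lambda>v. poly p (1 / v) * exp (- 1 / v)) has_real_derivative
        poly (flat_deriv p) (1 / v) * exp (- 1 / v)) (at v)"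
      using 3
      by (auto intro!: derivative_eq_intros simp: flat_deriv_def poly_monom power2_eq_square field_simps)
    then have "(flat p has_real_derivative poly (flat_deriv p) (1 / v) * exp (- 1 / v)) (at v)"
      by (rule has_field_derivative_transform_within_open[of _ _ _ "{0<..}"]) (use 3 in \<open>auto simp: flat_def\<close>)
    then show ?thesis using 3 by (simp add: flat_def)
  qed
qed

lemma flat_1_nonneg: "0 \<le> flat 1 v"
  by (simp add: flat_def)

lemma flat_1_pos: "0 < v \<Longrightarrow> 0 < flat 1 v"
  by (simp add: flat_def)

lemma flat_1_le_1: "flat 1 v \<le> 1"
  by (simp add: flat_def)

text \<open>With \<open>w = 1 / v\<close> this is \<open>w * exp (- w) \<le> 1\<close>. It turns
  into the linear bound on \<open>G\<close> that keeps orbits from crossing the critical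
  circle.\<close>

lemma flat_1_le: "flat 1 v \<le> max 0 v"
proof (cases "v \<le> 0")
  case False
  then have "(1 / v) ^ 1 * exp (- (1 / v)) \<le> fact 1" by (intro power_le_exp) simp
  then show ?thesis using False by (simp add: flat_def field_simps)
qed (simp add: flat_def)

text \<open>The constant is \<open>fact 2\<close>, which bounds the derivative
  \<open>w ^ 2 * exp (- w)\<close> with \<open>w = 1 / v\<close>.\<close>

lemma flat_1_lipschitz: "\<bar>flat 1 a - flat 1 b\<bar> \<le> 2 * \<bar>a - b\<bar>"
proof -
  have "norm (flat (flat_deriv 1) v) \<le> 2" for v
  proof (cases "v \<le> 0")
    case False
    then have "(1 / v) ^ 2 * exp (- (1 / v)) \<le> fact 2" by (intro power_le_exp) simp
    then show ?thesis using False by (simp add: flat_def flat_deriv_def poly_monom power_one_over[symmetric])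
  qed (simp add: flat_def)
  then show ?thesis
    using field_differentiable_bound[of UNIV "flat 1" "flat (flat_deriv 1)" 2 a b] flat_has_derivative by auto
qed

section \<open>The radial speed\<close>

definition F :: "real poly \<Rightarrow> real \<Rightarrow> real" where
  "F p u = (\<Sum>s. (1 / 2) ^ Suc s * flat p (q s - u))"

lemma summable_half: "summable (\<lambda>s. C * (1 / 2 :: real) ^ Suc s)"
  by (intro summable_mult summable_Suc_iff[THEN iffD2] summable_geometric) simp

lemma suminf_half: "(\<Sum>s. (1 / 2 :: real) ^ Suc s) = 1"
  using power_half_series by (simp add: sums_iff)

lemma F_term_bound: "\<exists>C. \<forall>s u. norm ((1 / 2) ^ Suc s * flat p (q s - u)) \<le> C * (1 / 2) ^ Suc s"
proof -
  obtain C where "\<And>v. \<bar>flat p v\<bar> \<le> C" using flat_bound by blast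
  then show ?thesis by (intro exI[of _ C]) (auto simp: abs_mult mult.commute intro!: mult_right_mono)
qed

lemma summable_F: "summable (\<lambda>s. (1 / 2) ^ Suc s * flat p (q s - u))"
proof -
  obtain C where "\<And>s u. norm ((1 / 2) ^ Suc s * flat p (q s - u)) \<le> C * (1 / 2) ^ Suc s"
    using F_term_bound by blast
  then show ?thesis by (intro summable_comparison_test'[OF summable_half]) auto
qed

text \<open>Termwise differentiation. The bound on \<open>flat\<close> is uniform in its argument,
  so the Weierstrass test applies with one geometric majorant, whatever the values of
  \<open>q\<close>.\<close>

lemma F_has_derivative: "(F p has_real_derivative - F (flat_deriv p) u) (at u)"
proof -
  let ?f = "\<lambda>s u. (1 / 2) ^ Suc s * flat p (q s - u)"
  let ?f' = "\<lambda>s u. - ((1 / 2) ^ Suc s * flat (flat_deriv p) (q s - u))"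
  have d: "(?f s has_real_derivative ?f' s u) (at u within UNIV)" for s u
  proof -
    have "((\<lambda>u. q s - u) has_real_derivative - 1) (at u)" by (auto intro!: derivative_eq_intros)
    from DERIV_chain2[OF flat_has_derivative this]
    have "((\<lambda>u. flat p (q s - u)) has_real_derivative - flat (flat_deriv p) (q s - u)) (at u)" by simp
    from DERIV_cmult[OF this, of "(1 / 2) ^ Suc s"] show ?thesis by (simp only: mult_minus_right)
  qed
  obtain C where C: "\<And>s u. norm ((1 / 2) ^ Suc s * flat (flat_deriv p) (q s - u)) \<le> C * (1 / 2) ^ Suc s"
    using F_term_bound by blast
  have lim: "uniform_limit UNIV (\<lambda>n u. \<Sum>i<n. ?f' i u) (\<lambda>u. \<Sum>i. ?f' i u) sequentially"
    using C by (intro Weierstrass_m_test[OF _ summable_half]) auto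
  obtain g where g: "\<And>u. (\<lambda>s. ?f s u) sums g u"
    "\<And>u. (g has_real_derivative (\<Sum>i. ?f' i u)) (at u)"
    using has_field_derivative_series[OF convex_UNIV d lim UNIV_I summable_F[of p 0]] by auto
  have "g = F p" using g(1) by (auto simp: F_def sums_iff fun_eq_iff)
  moreover have "(\<Sum>i. ?f' i u) = - F (flat_deriv p) u"
    unfolding F_def by (rule suminf_minus[OF summable_F])
  ultimately show ?thesis using g(2) by metis
qed

abbreviation G :: "real \<Rightarrow> real" where "G \<equiv> F 1"

lemma G_nonneg: "0 \<le> G u"
  unfolding F_def by (intro suminf_nonneg summable_F mult_nonneg_nonneg flat_1_nonneg) auto

lemma G_le_1: "G u \<le> 1"
proof -
  have "G u \<le> (\<Sum>s. (1 / 2) ^ Suc s)"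
    unfolding F_def using flat_1_le_1 summable_half[of 1]
    by (intro suminf_le summable_F) (auto intro: mult_left_le simp: mult_left_le)
  then show ?thesis by (simp only: suminf_half)
qed

lemma G_le: "G u \<le> max 0 (Q - u)"
proof -
  have "(1 / 2) ^ Suc s * flat 1 (q s - u) \<le> max 0 (Q - u) * (1 / 2) ^ Suc s" for s
  proof -
    have "flat 1 (q s - u) \<le> max 0 (Q - u)" using flat_1_le[of "q s - u"] q_le_Q[of s] by linarith
    then show ?thesis by (simp add: mult.commute)
  qed
  then have "G u \<le> (\<Sum>s. max 0 (Q - u) * (1 / 2) ^ Suc s)"
    unfolding F_def by (intro suminf_le summable_F summable_half) auto
  also have "\<dots> = max 0 (Q - u) * (\<Sum>s. (1 / 2) ^ Suc s)"
    using summable_half[of 1] by (intro suminf_mult) simp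
  finally show ?thesis by (simp only: suminf_half mult_1_right)
qed

lemma G_pos: "u < Q \<Longrightarrow> 0 < G u"
proof -
  assume "u < Q"
  then obtain s where "u < q s" using less_Q by blast
  then show ?thesis unfolding F_def
    by (intro suminf_pos2[OF summable_F, where i = s] mult_nonneg_nonneg flat_1_nonneg mult_pos_pos flat_1_pos) auto
qed

section \<open>The vector field\<close>

definition rot :: "real \<times> real \<Rightarrow> real \<times> real" where "rot z = (- snd z, fst z)"

definition field :: "real \<times> real \<Rightarrow> real \<times> real" where
  "field z = (- G (z \<bullet> z)) *\<^sub>R z + rot z"

lemma bounded_linear_rot: "bounded_linear rot"
  unfolding rot_def by (intro bounded_linear_Pair bounded_linear_minus bounded_linear_fst bounded_linear_snd)

lemma rot_inner: "rot z \<bullet> z = 0" "rot z \<bullet> rot z = z \<bullet> z"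
  by (auto simp: rot_def inner_prod_def)

lemma rot_simps: "rot (x + y) = rot x + rot y" "rot (c *\<^sub>R x) = c *\<^sub>R rot x" "rot (rot x) = - x"
  by (auto simp: rot_def prod_eq_iff)

lemma field_inner: "field z \<bullet> z = - G (z \<bullet> z) * (z \<bullet> z)"
  by (simp add: field_def inner_add_left inner_diff_left rot_inner)

lemma C_infinity_field: "C_infinity field"
  unfolding C_infinity_def
proof
  fix n
  \<comment> \<open>Each differentiation of \<open>F p\<close> changes the sign, so the index pairs
    the polynomial with a constant factor.\<close>
  have "C_k n (\<lambda>z :: real \<times> real. (\<lambda>(c, p) u. c * F p u) (- 1, 1) (z \<bullet> z))"
  proof (rule C_k_comp_norm_sq[where d = "\<lambda>(c, p). (- c, flat_deriv p)"])
    fix i :: "real \<times> real poly" and u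
    show "((case i of (c, p) \<Rightarrow> \<lambda>u. c * F p u) has_real_derivative
        (case case i of (c, p) \<Rightarrow> (- c, flat_deriv p) of (c, p) \<Rightarrow> \<lambda>u. c * F p u) u) (at u)"
      using DERIV_cmult[OF F_has_derivative[of "snd i" u], of "fst i"] by (simp add: case_prod_unfold)
  qed
  then have "C_k n (\<lambda>z :: real \<times> real. - G (z \<bullet> z))" by simp
  then show "C_k n field"
    unfolding field_def[abs_def]
    by (rule C_k_add[OF C_k_scaleR[OF _ C_k_bounded_linear[OF bounded_linear_ident]] C_k_bounded_linear[OF bounded_linear_rot]])
qed

lemma field_inward: "restrict field disk \<in> inward_fields"
proof -
  have "field x \<bullet> x < 0" if "x \<in> frontier disk" for x
  proof -
    have "norm x = 3" using that by simp
    then have "x \<bullet> x = 9" by (simp add: dot_square_norm)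
    then show ?thesis using G_pos[of 9] Q_bounds by (simp add: field_inner)
  qed
  moreover have "C1_on disk (restrict field disk)"
    using C_infinity_field by (intro C1_on_restrict) (simp add: C_infinity_def)
  ultimately show ?thesis by (auto simp: inward_fields_def)
qed

text \<open>Testing against \<open>rot x\<close> removes the radial part and leaves
  \<open>x \<bullet> x\<close>; this also covers the region where \<open>G\<close> vanishes.\<close>

lemma equilibrium_field: "equilibrium field x \<longleftrightarrow> x = 0"
proof
  assume "equilibrium field x"
  then have "field x \<bullet> rot x = 0" by (simp add: equilibrium_def)
  moreover have "field x \<bullet> rot x = x \<bullet> x"
    unfolding field_def inner_add_left inner_scaleR_left inner_commute[of x "rot x"] rot_inner by simp
  ultimately show "x = 0" by simp
qed (simp add: equilibrium_def field_def rot_def zero_prod_def)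

text \<open>Separation of variables: the solution is the inverse of a primitive of \<open>1 / g\<close>.\<close>

lemma scalar_ode_solution:
  fixes g :: "real \<Rightarrow> real"
  assumes cont: "continuous_on UNIV g" and g: "\<And>y. 0 < g y" "\<And>y. g y \<le> 1"
  obtains S where "S 0 = 0" "\<And>t. (S has_real_derivative g (S t)) (at t)" "mono S"
    "filterlim S at_top at_top"
proof -
  have "isCont (\<lambda>y. 1 / g y) y" for y
    using cont g(1)[of y] by (auto intro!: continuous_intros simp: continuous_on_eq_continuous_at)
  then obtain T0 where T0: "\<And>y. (T0 has_real_derivative 1 / g y) (at y)"
    using einterval_antiderivative[of "-\<infinity>" "\<infinity>" "\<lambda>y. 1 / g y"]
    by (auto simp: has_real_derivative_iff_has_vector_derivative)
  define T where "T y = T0 y - T0 0" for y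
  have T: "(T has_real_derivative 1 / g y) (at y)" for y
    unfolding T_def by (auto intro!: derivative_eq_intros T0)
  \<comment> \<open>As \<open>g \<le> 1\<close>, the primitive \<open>T\<close> has slope at least
    1. Hence it is onto, and its inverse \<open>S\<close> is monotone, 1-Lipschitz and defined for
    all times.\<close>
  have expand: "b - a \<le> T b - T a" if "a \<le> b" for a b
  proof -
    have "(\<lambda>y. T y - y) a \<le> (\<lambda>y. T y - y) b"
    proof (rule DERIV_nonneg_imp_nondecreasing[OF that])
      fix y
      have "((\<lambda>y. T y - y) has_real_derivative 1 / g y - 1) (at y)"
        by (auto intro!: derivative_eq_intros T)
      moreover have "0 \<le> 1 / g y - 1" using g[of y] by simp
      ultimately show "\<exists>d. ((\<lambda>y. T y - y) has_real_derivative d) (at y) \<and> 0 \<le> d" by blast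
    qed
    then show ?thesis by simp
  qed
  have T00: "T 0 = 0" by (simp add: T_def)
  have "\<exists>y. T y = t" for t
  proof -
    have "T (- \<bar>t\<bar>) \<le> t" "t \<le> T \<bar>t\<bar>"
      using expand[of "- \<bar>t\<bar>" 0] expand[of 0 "\<bar>t\<bar>"] T00 by auto
    moreover have "\<forall>x. - \<bar>t\<bar> \<le> x \<and> x \<le> \<bar>t\<bar> \<longrightarrow> isCont T x" using T DERIV_isCont by blast
    ultimately show ?thesis using IVT[of T "- \<bar>t\<bar>" t "\<bar>t\<bar>"] by auto
  qed
  then obtain S where S: "\<And>t. T (S t) = t" by metis
  have mono: "S a \<le> S b" if "a \<le> b" for a b
  proof (rule ccontr)
    assume "\<not> S a \<le> S b"
    then show False using expand[of "S b" "S a"] S that by simp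
  qed
  have lip: "\<bar>S a - S b\<bar> \<le> \<bar>a - b\<bar>" for a b
    using expand[of "S a" "S b"] expand[of "S b" "S a"] mono[of a b] mono[of b a] S
    by (cases "a \<le> b") auto
  have "continuous_on UNIV S"
    unfolding continuous_on_iff dist_real_def using lip by (meson UNIV_I le_less_trans)
  then have cont: "isCont S t" for t by (simp add: continuous_on_eq_continuous_at)
  have deriv: "(S has_real_derivative g (S t)) (at t)" for t
    using DERIV_inverse_function[OF T _ _ _ _ cont, of t "t - 1" "t + 1"] S g(1)[of "S t"] by simp
  have "S 0 = 0"
    using expand[of "S 0" 0] expand[of 0 "S 0"] T00 S[of 0] by (cases "S 0 \<le> 0") auto
  moreover have "filterlim S at_top at_top"
    unfolding filterlim_at_top
  proof
    fix Z
    have "Z \<le> S t" if "T Z \<le> t" for t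
    proof (rule ccontr)
      assume "\<not> Z \<le> S t"
      then show False using expand[of "S t" Z] S[of t] that by simp
    qed
    then show "\<forall>\<^sub>F t in at_top. Z \<le> S t" by (auto intro: eventually_at_top_linorderI)
  qed
  ultimately show ?thesis using deriv mono by (intro that[of S]) (auto intro: monoI)
qed

section \<open>The basin of attraction of the origin\<close>

lemma continuous_G: "continuous_on UNIV G"
  using F_has_derivative DERIV_isCont by (blast intro: continuous_at_imp_continuous_on)

text \<open>Ansatz: rotate \<open>z\<close> by the angle \<open>t\<close> and shrink it by
  \<open>exp (- S t)\<close>. Then the squared norm is \<open>?u * exp (- 2 * S t)\<close>, and the
  equation reduces to the scalar one \<open>S' = g (S)\<close>.\<close>

lemma inside_basin:
  assumes "norm z ^ 2 < Q"
  shows "z \<in> basin field 0"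
proof -
  let ?u = "z \<bullet> z"
  have u: "?u < Q" using assms by (simp add: power2_norm_eq_inner)
  \<comment> \<open>For negative \<open>y\<close> the argument of \<open>G\<close> could exceed
    \<open>Q\<close>, where \<open>G\<close> is zero; the cut-off by \<open>max\<close> keeps
    \<open>g\<close> positive everywhere and changes nothing for the values
    \<open>S t \<ge> 0\<close>.\<close>
  define g where "g y = G (?u * exp (- 2 * max 0 y))" for y
  have less: "?u * exp (- 2 * max 0 y) < Q" for y
  proof -
    have "?u * exp (- 2 * max 0 y) \<le> ?u * 1" by (intro mult_left_mono) auto
    then show ?thesis using u by simp
  qed
  have "continuous_on UNIV g"
    unfolding g_def by (intro continuous_on_compose2[OF continuous_G] continuous_intros) auto
  then obtain S where S: "S 0 = 0" "\<And>t. (S has_real_derivative g (S t)) (at t)" "mono S"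
    "filterlim S at_top at_top"
    using scalar_ode_solution[of g] G_pos[OF less] G_le_1 unfolding g_def by metis
  define w where "w t = cos t *\<^sub>R z + sin t *\<^sub>R rot z" for t
  define x where "x t = exp (- S t) *\<^sub>R w t" for t
  have ww: "w t \<bullet> w t = ?u" for t
  proof -
    have "w t \<bullet> w t = (cos t)\<^sup>2 * ?u + (sin t)\<^sup>2 * ?u"
      using rot_inner[of z] by (simp add: w_def inner_add_left inner_add_right inner_commute power2_eq_square algebra_simps)
    then show ?thesis by (simp add: distrib_right[symmetric])
  qed
  have dw: "(w has_vector_derivative rot (w t)) (at t)" for t
  proof -
    have "(w has_vector_derivative (- sin t *\<^sub>R z + cos t *\<^sub>R rot z)) (at t)"
      unfolding w_def by (auto intro!: derivative_eq_intros simp: has_real_derivative_iff_has_vector_derivative)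
    moreover have "rot (w t) = - sin t *\<^sub>R z + cos t *\<^sub>R rot z"
      by (simp add: w_def rot_simps)
    ultimately show ?thesis by simp
  qed
  have xx: "x t \<bullet> x t = ?u * exp (- 2 * S t)" for t
    by (simp add: x_def ww exp_double[symmetric] power2_eq_square mult_exp_exp)
  have "(x has_vector_derivative field (x t)) (at t within {0..})" if "0 \<le> t" for t
  proof -
    have "0 \<le> S t" using monoD[OF S(3) that] S(1) by simp
    then have gS: "g (S t) = G (x t \<bullet> x t)" by (simp add: g_def xx max_def)
    have "((\<lambda>t. exp (- S t)) has_real_derivative - g (S t) * exp (- S t)) (at t)"
      by (auto intro!: derivative_eq_intros S(2))
    from has_vector_derivative_scaleR[OF this dw]
    have "(x has_vector_derivative exp (- S t) *\<^sub>R rot (w t) + (- g (S t) * exp (- S t)) *\<^sub>R w t) (at t)"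
      by (simp add: x_def[abs_def])
    also have "exp (- S t) *\<^sub>R rot (w t) + (- g (S t) * exp (- S t)) *\<^sub>R w t = field (x t)"
      by (simp add: field_def gS[symmetric]) (simp add: x_def rot_simps)
    finally show ?thesis by (rule has_vector_derivative_at_within)
  qed
  moreover have "x 0 = z" by (simp add: x_def w_def S(1))
  moreover have "(x \<longlongrightarrow> 0) at_top"
  proof (rule tendsto_norm_zero_cancel)
    have "norm (w t) = norm z" for t using ww by (simp add: norm_eq_sqrt_inner)
    then have "norm (x t) = exp (- S t) * norm z" for t by (simp add: x_def)
    moreover have "((\<lambda>t. exp (- S t)) \<longlongrightarrow> 0) at_top"
      by (rule filterlim_compose[OF exp_at_bot]) (use S(4) in \<open>simp add: filterlim_uminus_at_bot\<close>)
    ultimately show "((\<lambda>t. norm (x t)) \<longlongrightarrow> 0) at_top"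
      using tendsto_mult_right[of "\<lambda>t. exp (- S t)" 0 at_top "norm z"] by (simp add: mult.commute)
  qed
  ultimately show ?thesis unfolding basin_def trajectory_def by blast
qed

text \<open>Uniqueness in disguise: \<open>(Q - norm (x t) ^ 2) * exp (- 2 * Q * t)\<close> cannot increase while positive.\<close>

lemma outside_invariant:
  assumes x: "trajectory field z x" and z: "Q \<le> norm z ^ 2" and t1: "0 \<le> t1"
  shows "Q \<le> norm (x t1) ^ 2"
proof (rule ccontr)
  define u where "u t = x t \<bullet> x t" for t
  assume "\<not> ?thesis"
  then have ut1: "u t1 < Q" by (simp add: u_def power2_norm_eq_inner)
  have x0: "x 0 = z" and dx: "\<And>t. 0 \<le> t \<Longrightarrow> (x has_vector_derivative field (x t)) (at t within {0..})"
    using x by (auto simp: trajectory_def)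
  have "continuous (at t within {0..}) x" if "0 \<le> t" for t
    using has_vector_derivative_continuous[OF dx[OF that]] .
  then have "continuous_on {0..} x" by (simp add: continuous_on_eq_continuous_within)
  then have cu: "continuous_on {0..} u" unfolding u_def by (intro continuous_intros)
  \<comment> \<open>The maximum \<open>t0\<close> of \<open>A\<close> is the last time up to
    \<open>t1\<close> at which the orbit is not inside the disc; after it the bound
    \<open>G (u t) \<le> Q - u t\<close> is available.\<close>
  define A where "A = {t \<in> {0..t1}. Q \<le> u t}"
  have "closed A"
    unfolding A_def by (intro continuous_on_closed_Collect_le continuous_intros continuous_on_subset[OF cu]) auto
  moreover have "bounded A" by (rule bounded_subset[of "{0..t1}"]) (auto simp: A_def)
  ultimately have "compact A" by (simp add: compact_eq_bounded_closed)
  moreover have "0 \<in> A" using t1 z x0 by (simp add: A_def u_def power2_norm_eq_inner)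
  ultimately obtain t0 where t0: "t0 \<in> A" "\<And>t. t \<in> A \<Longrightarrow> t \<le> t0"
    using compact_attains_sup[of A] by blast
  have t0': "0 \<le> t0" "t0 \<le> t1" "Q \<le> u t0" using t0 by (auto simp: A_def)
  have below: "u t < Q" if "t0 < t" "t \<le> t1" for t
    using t0(2)[of t] that t0' by (force simp: A_def)
  define \<phi> where "\<phi> t = (Q - u t) * exp (- 2 * Q * t)" for t
  have "\<phi> t1 \<le> \<phi> t0"
  proof (rule DERIV_nonpos_imp_decreasing_open[OF t0'(2)])
    fix t assume t: "t0 < t" "t < t1"
    have "(x has_vector_derivative field (x t)) (at t)"
      using dx[of t] t t0' by (simp add: at_within_interior[of t "{0..}"])
    then have "(u has_real_derivative 2 * (field (x t) \<bullet> x t)) (at t)"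
      unfolding u_def has_real_derivative_iff_has_vector_derivative has_vector_derivative_def
      by (auto intro!: derivative_eq_intros simp: inner_commute algebra_simps)
    then have "(u has_real_derivative - 2 * u t * G (u t)) (at t)"
      by (simp add: field_inner u_def mult_ac)
    then have "(\<phi> has_real_derivative (2 * u t * G (u t) - 2 * Q * (Q - u t)) * exp (- 2 * Q * t)) (at t)"
      unfolding \<phi>_def
      by (auto intro!: derivative_eq_intros simp: algebra_simps)
    moreover have "(2 * u t * G (u t) - 2 * Q * (Q - u t)) * exp (- 2 * Q * t) \<le> 0"
    proof -
      have "u t < Q" using below t by simp
      then have "G (u t) \<le> Q - u t" using G_le[of "u t"] by simp
      moreover have "0 \<le> u t" by (simp add: u_def)
      ultimately have "u t * G (u t) \<le> Q * (Q - u t)"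
        using \<open>u t < Q\<close> G_nonneg[of "u t"] by (intro mult_mono) auto
      then show ?thesis by (simp add: mult_le_0_iff)
    qed
    ultimately show "\<exists>y. (\<phi> has_real_derivative y) (at t) \<and> y \<le> 0" by blast
  next
    show "continuous_on {t0..t1} \<phi>"
      unfolding \<phi>_def using t0' by (intro continuous_intros continuous_on_subset[OF cu]) auto
  qed
  moreover have "\<phi> t0 \<le> 0" using t0' by (simp add: \<phi>_def mult_le_0_iff)
  moreover have "0 < \<phi> t1" using ut1 by (simp add: \<phi>_def)
  ultimately show False by simp
qed

lemma basin_field: "basin field 0 = {z. norm z ^ 2 < Q}"
proof -
  have False if z: "z \<in> basin field 0" "Q \<le> norm z ^ 2" for z
  proof -
    obtain x where x: "trajectory field z x" "(x \<longlongrightarrow> 0) at_top"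
      using z(1) unfolding basin_def mem_Collect_eq by blast
    have "((\<lambda>t. norm (x t) ^ 2) \<longlongrightarrow> norm (0 :: real \<times> real) ^ 2) at_top"
      by (intro tendsto_intros x(2))
    moreover have "\<forall>\<^sub>F t in at_top. Q \<le> norm (x t) ^ 2"
      using outside_invariant[OF x(1) z(2)] by (auto intro: eventually_at_top_linorderI[of 0])
    ultimately have "Q \<le> norm (0 :: real \<times> real) ^ 2" by (intro tendsto_lowerbound) auto
    then show False using Q_bounds by simp
  qed
  then show ?thesis using inside_basin by (auto simp: not_less[symmetric])
qed

lemma sink_field: "sink field 0"
proof -
  have "open {z :: real \<times> real. norm z ^ 2 < Q}" by (intro open_Collect_less continuous_intros)
  moreover have "0 \<in> {z :: real \<times> real. norm z ^ 2 < Q}" using Q_bounds by simp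
  ultimately show ?thesis
    unfolding sink_def basin_field equilibrium_field by blast
qed

section \<open>Polynomial approximation\<close>

text \<open>With \<open>w = b / a\<close> this compares \<open>(1 + w / m) ^ (- m)\<close> with \<open>exp (- w)\<close>.\<close>

lemma flat_rational_approx:
  fixes a b :: real
  assumes ab: "0 \<le> a" "0 < b" and m: "even m" "0 < m"
  shows "\<bar>(a * real m) ^ m / (a * real m + b) ^ m - flat 1 (a / b)\<bar> \<le> 4 / real m"
proof (cases "a = 0")
  case True
  then show ?thesis using m by (simp add: flat_def zero_power)
next
  case False
  then have a: "0 < a" using ab by simp
  define w where "w = b / a"
  define E where "E = (1 + w / real m) ^ m"
  define e where "e = exp (- w)"
  have w: "0 < w" using a ab by (simp add: w_def)
  have E: "0 < E" using w by (simp add: E_def add_pos_nonneg)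
  have e: "0 < e" by (simp add: e_def)
  have "a * real m / (a * real m + b) = 1 / (1 + w / real m)"
    using a ab m by (simp add: w_def field_simps)
  then have 1: "(a * real m) ^ m / (a * real m + b) ^ m = 1 / E"
    by (simp only: power_divide[symmetric] E_def) (simp add: power_one_over)
  have 2: "flat 1 (a / b) = e" using a ab by (simp add: flat_def e_def w_def divide_le_0_iff)
  have "E \<le> exp w" unfolding E_def using w m by (intro exp_ge_one_plus_x_over_n_power_n) auto
  then have upper: "E * e \<le> 1" by (simp add: e_def exp_minus field_simps)
  \<comment> \<open>With \<open>x = w / m\<close> and \<open>exp (- x) \<ge> 1 - x\<close>, the
    product is at least \<open>(1 - x ^ 2) ^ m\<close>, to which Bernoulli applies. If
    \<open>w\<close> exceeds \<open>m\<close>, the left side is not positive.\<close>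
  have lower: "1 - w\<^sup>2 / real m \<le> E * e"
  proof (cases "w \<le> real m")
    case True
    define x where "x = w / real m"
    have x: "0 \<le> x" "x \<le> 1" using True w m by (auto simp: x_def)
    have "1 - w\<^sup>2 / real m = 1 + real m * (- x\<^sup>2)"
      using m by (simp add: x_def power2_eq_square field_simps)
    also have "\<dots> \<le> (1 + (- x\<^sup>2)) ^ m"
      using x by (intro Bernoulli_inequality) (simp add: power_le_one)
    also have "\<dots> = ((1 + x) * (1 + - x)) ^ m" by (simp add: power2_eq_square algebra_simps)
    also have "\<dots> \<le> ((1 + x) * exp (- x)) ^ m"
      using x exp_ge_add_one_self[of "- x"] by (intro power_mono mult_left_mono) auto
    also have "\<dots> = E * e"
      using m by (simp add: power_mult_distrib E_def e_def x_def exp_of_nat_mult[symmetric])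
    finally show ?thesis .
  next
    case False
    then have "1 \<le> w * (w / real m)" using m by (intro mult_ge1_I) auto
    then have "1 - w\<^sup>2 / real m \<le> 0" by (simp add: power2_eq_square)
    also have "0 \<le> E * e" using E e by simp
    finally show ?thesis .
  qed
  \<comment> \<open>The error is at most \<open>w ^ 2 / (m * E)\<close>, which must be bounded
    uniformly in \<open>w\<close>. Since \<open>m\<close> is even, \<open>E\<close> is the square of
    a power that Bernoulli bounds below by \<open>w / 2\<close>.\<close>
  have big: "w\<^sup>2 / 4 \<le> E"
  proof -
    obtain k where k: "m = 2 * k" using m by blast
    have "- 1 \<le> (0::real)" "0 \<le> w / real m" using w by auto
    then have "- 1 \<le> w / real m" by linarith
    note bern = Bernoulli_inequality[OF this, of k]
    have "w / 2 = real k * (w / real m)" using m k by simp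
    also have "\<dots> \<le> 1 + real k * (w / real m)" by simp
    also have "\<dots> \<le> (1 + w / real m) ^ k" by (rule bern)
    finally have "(w / 2)\<^sup>2 \<le> ((1 + w / real m) ^ k)\<^sup>2" using w by (intro power_mono) auto
    moreover have "E = ((1 + w / real m) ^ k)\<^sup>2" by (simp only: E_def k power_even_eq)
    ultimately show ?thesis by (simp add: power_divide)
  qed
  have "\<bar>1 / E - e\<bar> = (1 - E * e) / E"
    using upper E by (simp add: field_simps abs_if)
  also have "\<dots> \<le> (w\<^sup>2 / real m) / E"
    using lower E by (intro divide_right_mono) auto
  also have "\<dots> = (w\<^sup>2 / E) / real m" by simp
  also have "\<dots> \<le> 4 / real m"
    using big E by (intro divide_right_mono) (auto simp: field_simps)
  finally show ?thesis by (simp only: 1 2)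
qed

text \<open>This is the variance of the mean of \<open>n\<close> independent trials with success
  probability \<open>x\<close>, computed from the three moment identities for Bernstein
  polynomials.\<close>

lemma Bernstein_variance:
  assumes "0 < n"
  shows "(\<Sum>k\<le>n. (x - real k / real n)\<^sup>2 * Bernstein n k x) = x * (1 - x) / real n"
proof -
  have "(x - real k / real n)\<^sup>2 * Bernstein n k x =
     x\<^sup>2 * Bernstein n k x + (1 / (real n)\<^sup>2 - 2 * x / real n) * (real k * Bernstein n k x)
     + 1 / (real n)\<^sup>2 * (real k * (real k - 1) * Bernstein n k x)" for k
    using assms by (simp add: power2_eq_square field_simps)
  then have "(\<Sum>k\<le>n. (x - real k / real n)\<^sup>2 * Bernstein n k x) =
     x\<^sup>2 + (1 / (real n)\<^sup>2 - 2 * x / real n) * (real n * x) + 1 / (real n)\<^sup>2 * (real n * (real n - 1) * x\<^sup>2)"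
    by (simp only: sum.distrib sum_distrib_left[symmetric] sum_Bernstein sum_k_Bernstein sum_kk_Bernstein mult_1_right)
  also have "\<dots> = x * (1 - x) / real n"
    using assms by (simp add: power2_eq_square field_simps)
  finally show ?thesis .
qed

text \<open>The mean of \<open>\<bar>d\<bar>\<close> is estimated through the variance by
  \<open>\<bar>d\<bar> \<le> 1 / (2 * N) + N / 2 * d ^ 2\<close>. With degree \<open>N ^ 2\<close>
  both parts contribute at most \<open>L / (2 * N)\<close>.\<close>

lemma Bernstein_lipschitz_approx:
  assumes N: "0 < N" and x: "0 \<le> x" "x \<le> 1"
    and f: "\<And>a b. \<bar>f a - f b\<bar> \<le> L * \<bar>a - b\<bar>" and L: "0 \<le> L"
  shows "\<bar>(\<Sum>k\<le>N\<^sup>2. f (real k / real (N\<^sup>2)) * Bernstein (N\<^sup>2) k x) - f x\<bar> \<le> L / real N"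
proof -
  let ?n = "N\<^sup>2"
  have n: "0 < ?n" using N by simp
  have amgm: "\<bar>d\<bar> \<le> 1 / (2 * real N) + real N / 2 * d\<^sup>2" for d :: real
  proof -
    have "0 \<le> (real N * \<bar>d\<bar> - 1)\<^sup>2" by simp
    also have "\<dots> = (real N)\<^sup>2 * d\<^sup>2 - 2 * (real N * \<bar>d\<bar>) + 1"
      by (simp add: power2_diff power_mult_distrib)
    finally show ?thesis using N by (simp add: field_simps power2_eq_square)
  qed
  have "(\<Sum>k\<le>?n. f (real k / real ?n) * Bernstein ?n k x) - f x
      = (\<Sum>k\<le>?n. (f (real k / real ?n) - f x) * Bernstein ?n k x)"
    by (simp only: left_diff_distrib sum_subtractf sum_distrib_left[symmetric] sum_Bernstein mult_1_right)
  then have "\<bar>(\<Sum>k\<le>?n. f (real k / real ?n) * Bernstein ?n k x) - f x\<bar>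
      \<le> (\<Sum>k\<le>?n. \<bar>(f (real k / real ?n) - f x) * Bernstein ?n k x\<bar>)"
    by (simp only: sum_abs)
  also have "\<dots> \<le> (\<Sum>k\<le>?n. L * (1 / (2 * real N)) * Bernstein ?n k x
      + L * (real N / 2) * ((x - real k / real ?n)\<^sup>2 * Bernstein ?n k x))"
  proof (rule sum_mono)
    fix k
    have B: "0 \<le> Bernstein ?n k x" using x by (rule Bernstein_nonneg)
    have "\<bar>f (real k / real ?n) - f x\<bar> \<le> L * \<bar>x - real k / real ?n\<bar>"
      using f[of "real k / real ?n" x] by (simp add: abs_minus_commute)
    also have "\<dots> \<le> L * (1 / (2 * real N) + real N / 2 * (x - real k / real ?n)\<^sup>2)"
      using amgm L by (rule mult_left_mono)
    finally have "\<bar>f (real k / real ?n) - f x\<bar> * Bernstein ?n k x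
        \<le> L * (1 / (2 * real N) + real N / 2 * (x - real k / real ?n)\<^sup>2) * Bernstein ?n k x"
      using B by (rule mult_right_mono)
    then show "\<bar>(f (real k / real ?n) - f x) * Bernstein ?n k x\<bar> \<le> L * (1 / (2 * real N)) * Bernstein ?n k x
      + L * (real N / 2) * ((x - real k / real ?n)\<^sup>2 * Bernstein ?n k x)"
      using B by (simp only: abs_mult abs_of_nonneg) (simp only: algebra_simps)
  qed
  also have "\<dots> = L * (1 / (2 * real N)) + L * (real N / 2) * (x * (1 - x) / real ?n)"
    by (simp only: sum.distrib sum_distrib_left[symmetric] sum_Bernstein Bernstein_variance[OF n] mult_1_right)
  also have "\<dots> \<le> L * (1 / (2 * real N)) + L * (real N / 2) * (1 / real ?n)"
    using x L by (intro add_left_mono mult_left_mono divide_right_mono mult_le_one) auto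
  also have "\<dots> = L / real N"
    using N by (simp add: power2_eq_square field_simps)
  finally show ?thesis .
qed

text \<open>\<open>node N B s i\<close> over \<open>2 ^ s * N\<^sup>2\<close> is \<open>q s - B * i / N\<^sup>2\<close>, cut off at 0, where \<open>flat\<close> vanishes.\<close>

definition node :: "nat \<Rightarrow> nat \<Rightarrow> nat \<Rightarrow> nat \<Rightarrow> nat" where
  "node N B s i = numer s * N\<^sup>2 - i * B * 2 ^ s"

text \<open>A rational substitute for the value of \<open>flat 1\<close> at a node: the exponential
  is replaced by the power from \<open>flat_rational_approx\<close> with \<open>m = N\<close>, so
  numerator and denominator are natural numbers.\<close>

definition sample :: "nat \<Rightarrow> nat \<Rightarrow> nat \<Rightarrow> nat \<Rightarrow> real" where
  "sample N B s i = real ((node N B s i * N) ^ N) / real ((node N B s i * N + 2 ^ s * N\<^sup>2) ^ N)"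

definition G_approx :: "nat \<Rightarrow> nat \<Rightarrow> nat \<Rightarrow> real \<Rightarrow> real" where
  "G_approx S N B u = (\<Sum>s<S. (1 / 2) ^ Suc s * (\<Sum>i\<le>N\<^sup>2. sample N B s i * Bernstein (N\<^sup>2) i (u / real B)))"

lemma sample_approx:
  assumes "even N" "0 < N"
  shows "\<bar>sample N B s i - flat 1 (q s - real B * (real i / real (N\<^sup>2)))\<bar> \<le> 4 / real N"
proof -
  let ?a = "real (node N B s i)" and ?b = "2 ^ s * (real N)\<^sup>2"
  let ?v = "q s - real B * (real i / real (N\<^sup>2))"
  have b: "0 < ?b" using assms by simp
  have "?v = (real (numer s) * (real N)\<^sup>2 - real i * real B * 2 ^ s) / ?b"
    using assms by (simp add: numer_q[symmetric] field_simps)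
  moreover have "?a = max 0 (real (numer s) * (real N)\<^sup>2 - real i * real B * 2 ^ s)"
  proof -
    have "real (x - y) = max 0 (real x - real y)" for x y :: nat by (simp add: of_nat_diff_if)
    from this[of "numer s * N\<^sup>2" "i * B * 2 ^ s"] show ?thesis by (simp add: node_def)
  qed
  ultimately have "?a / ?b = max 0 ?v" using b by (simp add: max_def field_simps)
  moreover have "flat 1 (max 0 ?v) = flat 1 ?v" by (simp add: flat_def max_def)
  ultimately have "flat 1 (?a / ?b) = flat 1 ?v" by simp
  then show ?thesis
    using flat_rational_approx[of ?a ?b N] b assms by (simp add: sample_def)
qed

text \<open>The tail of the series is at most \<open>(1 / 2) ^ S\<close>. Rescaling to the unit
  interval gives Lipschitz constant \<open>2 * B\<close> and Bernstein error
  \<open>2 * B / N\<close>; the rational samples add \<open>4 / N\<close>, at most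
  \<open>4 * B / N\<close> as \<open>B \<ge> 1\<close>.\<close>

lemma G_approx_error:
  assumes N: "even N" "0 < N" and B: "0 < B" and u: "0 \<le> u" "u \<le> real B"
  shows "\<bar>G_approx S N B u - G u\<bar> \<le> (1 / 2) ^ S + 6 * real B / real N"
proof -
  let ?n = "N\<^sup>2" and ?x = "u / real B"
  define A where "A s = (\<Sum>i\<le>?n. sample N B s i * Bernstein ?n i ?x)" for s
  define f where "f s t = flat 1 (q s - real B * t)" for s t
  have x: "0 \<le> ?x" "?x \<le> 1" using u B by auto
  have err: "\<bar>A s - flat 1 (q s - u)\<bar> \<le> 6 * real B / real N" for s
  proof -
    let ?M = "\<Sum>i\<le>?n. f s (real i / real ?n) * Bernstein ?n i ?x"
    have "\<bar>f s a - f s b\<bar> \<le> 2 * real B * \<bar>a - b\<bar>" for a b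
    proof -
      have "\<bar>f s a - f s b\<bar> \<le> 2 * \<bar>(q s - real B * a) - (q s - real B * b)\<bar>"
        unfolding f_def by (rule flat_1_lipschitz)
      also have "(q s - real B * a) - (q s - real B * b) = real B * (b - a)" by (simp add: algebra_simps)
      finally show ?thesis by (simp add: abs_mult abs_minus_commute)
    qed
    then have 1: "\<bar>?M - f s ?x\<bar> \<le> 2 * real B / real N"
      using N x by (intro Bernstein_lipschitz_approx) auto
    have "A s - ?M = (\<Sum>i\<le>?n. (sample N B s i - f s (real i / real ?n)) * Bernstein ?n i ?x)"
      by (simp only: A_def left_diff_distrib sum_subtractf)
    then have "\<bar>A s - ?M\<bar> \<le> (\<Sum>i\<le>?n. \<bar>(sample N B s i - f s (real i / real ?n)) * Bernstein ?n i ?x\<bar>)"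
      by (simp only: sum_abs)
    also have "\<dots> \<le> (\<Sum>i\<le>?n. 4 / real N * Bernstein ?n i ?x)"
    proof (rule sum_mono)
      fix i
      have "\<bar>sample N B s i - f s (real i / real ?n)\<bar> * Bernstein ?n i ?x \<le> 4 / real N * Bernstein ?n i ?x"
        unfolding f_def by (intro mult_right_mono sample_approx N Bernstein_nonneg x)
      then show "\<bar>(sample N B s i - f s (real i / real ?n)) * Bernstein ?n i ?x\<bar> \<le> 4 / real N * Bernstein ?n i ?x"
        by (simp only: abs_mult abs_of_nonneg Bernstein_nonneg x)
    qed
    also have "\<dots> = 4 / real N" by (simp only: sum_distrib_left[symmetric] sum_Bernstein mult_1_right)
    finally have 2: "\<bar>A s - ?M\<bar> \<le> 4 / real N" .
    have "4 / real N \<le> 4 * real B / real N" using B by (intro divide_right_mono) auto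
    moreover have "6 * real B / real N = 2 * real B / real N + 4 * real B / real N"
      by (simp add: add_divide_distrib[symmetric])
    moreover have "f s ?x = flat 1 (q s - u)" using B by (simp add: f_def)
    ultimately show ?thesis using 1 2 by linarith
  qed
  have half: "(\<Sum>s<S. (1 / 2 :: real) ^ Suc s) = 1 - (1 / 2) ^ S" by (induction S) auto
  have "G u = (\<Sum>s. (1 / 2) ^ Suc (s + S) * flat 1 (q (s + S) - u)) + (\<Sum>s<S. (1 / 2) ^ Suc s * flat 1 (q s - u))"
    unfolding F_def by (rule suminf_split_initial_segment[OF summable_F])
  moreover have "0 \<le> (\<Sum>s. (1 / 2) ^ Suc (s + S) * flat 1 (q (s + S) - u))"
    using summable_ignore_initial_segment[OF summable_F[of 1 u], of S]
    by (intro suminf_nonneg) (auto simp: flat_1_nonneg)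
  moreover have "(\<Sum>s. (1 / 2) ^ Suc (s + S) * flat 1 (q (s + S) - u)) \<le> (1 / 2) ^ S"
  proof -
    have "(\<Sum>s. (1 / 2) ^ Suc (s + S) * flat 1 (q (s + S) - u)) \<le> (\<Sum>s. (1 / 2) ^ S * (1 / 2) ^ Suc s)"
      using summable_ignore_initial_segment[OF summable_F[of 1 u], of S] summable_half[of "(1 / 2) ^ S"] flat_1_le_1
      by (intro suminf_le) (auto simp: power_add mult_left_le)
    also have "\<dots> = (1 / 2) ^ S * (\<Sum>s. (1 / 2) ^ Suc s)" using summable_half[of 1] by (intro suminf_mult) simp
    finally show ?thesis by (simp only: suminf_half mult_1_right)
  qed
  moreover have "\<bar>G_approx S N B u - (\<Sum>s<S. (1 / 2) ^ Suc s * flat 1 (q s - u))\<bar> \<le> 6 * real B / real N"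
  proof -
    have "G_approx S N B u - (\<Sum>s<S. (1 / 2) ^ Suc s * flat 1 (q s - u))
        = (\<Sum>s<S. (1 / 2) ^ Suc s * (A s - flat 1 (q s - u)))"
      by (simp only: G_approx_def A_def right_diff_distrib sum_subtractf)
    then have "\<bar>G_approx S N B u - (\<Sum>s<S. (1 / 2) ^ Suc s * flat 1 (q s - u))\<bar>
        \<le> (\<Sum>s<S. \<bar>(1 / 2) ^ Suc s * (A s - flat 1 (q s - u))\<bar>)"
      by (simp only: sum_abs)
    also have "\<dots> \<le> (\<Sum>s<S. (1 / 2) ^ Suc s * (6 * real B / real N))"
      using err by (intro sum_mono) (simp only: abs_mult abs_of_nonneg zero_le_power zero_le_divide_1_iff zero_le_numeral mult_left_mono)
    also have "\<dots> = (1 - (1 / 2) ^ S) * (6 * real B / real N)"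
      by (simp only: sum_distrib_right[symmetric] half)
    also have "\<dots> \<le> 1 * (6 * real B / real N)" by (intro mult_right_mono) auto
    finally show ?thesis by simp
  qed
  ultimately show ?thesis by linarith
qed

text \<open>The powers of \<open>1 - v\<close> and of \<open>X + Y\<close> are expanded by the
  binomial theorem. Vanishing binomial coefficients pad the sums to ranges independent of
  \<open>i\<close> and \<open>j\<close>, so that the monomials can be numbered by division with
  remainder.\<close>

lemma Bernstein_expand:
  fixes X Y B :: real
  assumes i: "i \<le> n" and B: "B \<noteq> 0"
  shows "Bernstein n i ((X + Y) / B) = (\<Sum>j<Suc n. \<Sum>p<Suc (2 * n).
     real ((n choose i) * ((n - i) choose j) * ((i + j) choose p)) * (- 1) ^ j * X ^ p * Y ^ (i + j - p) / B ^ (i + j))"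
proof -
  let ?v = "(X + Y) / B"
  have pow: "?v ^ m = (\<Sum>p<Suc (2 * n). real (m choose p) * X ^ p * Y ^ (m - p) / B ^ m)" if "m \<le> 2 * n" for m
  proof -
    have "?v ^ m = (\<Sum>p\<le>m. real (m choose p) * X ^ p * Y ^ (m - p) / B ^ m)"
      unfolding power_divide binomial_ring sum_divide_distrib ..
    also have "\<dots> = (\<Sum>p<Suc (2 * n). real (m choose p) * X ^ p * Y ^ (m - p) / B ^ m)"
      using that by (intro sum.mono_neutral_left) (auto simp: binomial_eq_0)
    finally show ?thesis .
  qed
  have "(1 - ?v) ^ (n - i) = (\<Sum>j\<le>n - i. real ((n - i) choose j) * (- ?v) ^ j)"
    using binomial_ring[of "- ?v" 1 "n - i"] by simp
  also have "\<dots> = (\<Sum>j<Suc n. real ((n - i) choose j) * (- ?v) ^ j)"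
    by (intro sum.mono_neutral_left) (auto simp: binomial_eq_0)
  finally have "Bernstein n i ?v = (\<Sum>j<Suc n. real (n choose i) * ?v ^ i * (real ((n - i) choose j) * (- ?v) ^ j))"
    by (simp only: Bernstein_def sum_distrib_left)
  also have "\<dots> = (\<Sum>j<Suc n. \<Sum>p<Suc (2 * n).
     real ((n choose i) * ((n - i) choose j) * ((i + j) choose p)) * (- 1) ^ j * X ^ p * Y ^ (i + j - p) / B ^ (i + j))"
  proof (rule sum.cong[OF refl])
    fix j assume "j \<in> {..<Suc n}"
    then have "i + j \<le> 2 * n" using i by simp
    have "real (n choose i) * ?v ^ i * (real ((n - i) choose j) * (- ?v) ^ j)
       = real (n choose i) * real ((n - i) choose j) * (- 1) ^ j * ?v ^ (i + j)"
      by (simp add: power_minus[of ?v j] power_add)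
    also have "\<dots> = (\<Sum>p<Suc (2 * n).
     real ((n choose i) * ((n - i) choose j) * ((i + j) choose p)) * (- 1) ^ j * X ^ p * Y ^ (i + j - p) / B ^ (i + j))"
      unfolding pow[OF \<open>i + j \<le> 2 * n\<close>] sum_distrib_left by (intro sum.cong refl) simp
    finally show "real (n choose i) * ?v ^ i * (real ((n - i) choose j) * (- ?v) ^ j) = \<dots>" .
  qed
  finally show ?thesis .
qed

section \<open>Codes of the approximating polynomials\<close>

lemma sum_div_mod:
  fixes f :: "nat \<Rightarrow> nat \<Rightarrow> 'a::comm_monoid_add"
  shows "(\<Sum>t<A * K. f (t div K) (t mod K)) = (\<Sum>s<A. \<Sum>r<K. f s r)"
proof -
  have "(\<Sum>t<A * K. f (t div K) (t mod K)) = (\<Sum>s<A. \<Sum>t\<in>{s * K..<s * K + K}. f (t div K) (t mod K))"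
    by (rule sum.nat_group[symmetric])
  also have "\<dots> = (\<Sum>s<A. \<Sum>r<K. f s r)"
  proof (rule sum.cong[OF refl])
    fix s
    have "(\<Sum>t\<in>{s * K..<s * K + K}. f (t div K) (t mod K)) = (\<Sum>r<K. f ((s * K + r) div K) ((s * K + r) mod K))"
      by (simp add: sum.atLeastLessThan_shift_0[of _ "s * K"] lessThan_atLeast0)
    also have "\<dots> = (\<Sum>r<K. f s r)" by (intro sum.cong) auto
    finally show "(\<Sum>t\<in>{s * K..<s * K + K}. f (t div K) (t mod K)) = (\<Sum>r<K. f s r)" .
  qed
  finally show ?thesis .
qed

text \<open>Under \<open>int_decode\<close>, \<open>2 * a - 1\<close> stands for \<open>- a\<close>;
  for \<open>a = 0\<close> truncation gives 0, again the code of zero. The code of a fraction stores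
  its denominator minus one.\<close>

definition mono_code :: "nat \<Rightarrow> nat \<Rightarrow> nat \<Rightarrow> nat \<Rightarrow> nat \<Rightarrow> nat" where
  "mono_code sg a d ex ey = prod_encode (prod_encode (ex, ey),
     prod_encode (if odd sg then 2 * a - 1 else 2 * a, d - 1))"

lemma monomial_mono_code:
  assumes "0 < d"
  shows "monomial_of_code (mono_code sg a d ex ey) z = (- 1) ^ sg * (real a / real d) * fst z ^ ex * snd z ^ ey"
proof -
  have "int_decode (if odd sg then 2 * a - 1 else 2 * a) = (- 1) ^ sg * int a"
  proof (cases "odd sg \<and> a \<noteq> 0")
    case True
    then obtain b where "a = Suc b" by (cases a) auto
    then show ?thesis using True by (simp add: int_decode_def sum_decode_def)
  next
    case False
    then show ?thesis by (cases "a = 0") (auto simp: int_decode_def sum_decode_def)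
  qed
  then show ?thesis using assms by (simp add: monomial_of_code_def mono_code_def rat_of_code_def)
qed

text \<open>The coordinate \<open>c\<close> of the field is \<open>- G (x\<^sup>2 + y\<^sup>2) * x ^ (1 - c) * y ^ c\<close> plus \<open>- y\<close> or \<open>x\<close>.\<close>

definition term_code :: "nat \<Rightarrow> nat \<Rightarrow> nat \<Rightarrow> nat \<Rightarrow> nat \<Rightarrow> nat \<Rightarrow> nat \<Rightarrow> nat" where
  "term_code c N B s i j p = mono_code (Suc j)
     ((N\<^sup>2 choose i) * ((N\<^sup>2 - i) choose j) * ((i + j) choose p) * (node N B s i * N) ^ N)
     (2 ^ Suc s * (node N B s i * N + 2 ^ s * N\<^sup>2) ^ N * B ^ (i + j))
     (2 * p + (1 - c)) (2 * (i + j - p) + c)"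

lemma sum_term_code:
  assumes "0 < N" "0 < B" "i \<le> N\<^sup>2"
  shows "(\<Sum>j<Suc (N\<^sup>2). \<Sum>p<Suc (2 * N\<^sup>2). monomial_of_code (term_code c N B s i j p) (x, y))
    = - (x ^ (1 - c) * y ^ c) * ((1 / 2) ^ Suc s * (sample N B s i * Bernstein (N\<^sup>2) i ((x\<^sup>2 + y\<^sup>2) / real B)))"
proof -
  let ?n = "N\<^sup>2"
  let ?D = "(node N B s i * N + 2 ^ s * N\<^sup>2) ^ N"
  have D: "0 < ?D" using assms by simp
  have "monomial_of_code (term_code c N B s i j p) (x, y) =
     - (x ^ (1 - c) * y ^ c) * ((1 / 2) ^ Suc s * (sample N B s i *
     (real ((?n choose i) * ((?n - i) choose j) * ((i + j) choose p)) * (- 1) ^ j * (x\<^sup>2) ^ p * (y\<^sup>2) ^ (i + j - p) / real B ^ (i + j))))" for j p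
  proof -
    have "0 < 2 ^ Suc s * ?D * B ^ (i + j)" using D assms by simp
    then have "monomial_of_code (term_code c N B s i j p) (x, y) = (- 1) ^ Suc j *
      (real ((?n choose i) * ((?n - i) choose j) * ((i + j) choose p) * (node N B s i * N) ^ N) / real (2 ^ Suc s * ?D * B ^ (i + j)))
      * x ^ (2 * p + (1 - c)) * y ^ (2 * (i + j - p) + c)"
      unfolding term_code_def by (simp only: monomial_mono_code fst_conv snd_conv)
    also have "\<dots> = - (x ^ (1 - c) * y ^ c) * ((1 / 2) ^ Suc s * (sample N B s i *
     (real ((?n choose i) * ((?n - i) choose j) * ((i + j) choose p)) * (- 1) ^ j * (x\<^sup>2) ^ p * (y\<^sup>2) ^ (i + j - p) / real B ^ (i + j))))"
      unfolding sample_def of_nat_mult[of _ "(node N B s i * N) ^ N"] of_nat_mult[of _ "B ^ (i + j)"] of_nat_mult[of _ ?D]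
        power_add[of x] power_add[of y] power_mult
      by (simp add: power_one_over mult_ac)
    finally show ?thesis .
  qed
  then show ?thesis
    using Bernstein_expand[OF assms(3), of "real B" "x\<^sup>2" "y\<^sup>2"] assms(2)
    by (simp only: sum_distrib_left[symmetric])
qed

text \<open>The number \<open>t\<close> is read in mixed radix with digits \<open>s\<close>,
  \<open>i\<close>, \<open>j\<close>, \<open>p\<close>, so one list enumerates the fourfold
  sum.\<close>

definition mono_at :: "nat \<Rightarrow> nat \<Rightarrow> nat \<Rightarrow> nat \<Rightarrow> nat" where
  "mono_at c N B t = term_code c N B (t div (Suc (N\<^sup>2) * (Suc (N\<^sup>2) * Suc (2 * N\<^sup>2))))
     (t mod (Suc (N\<^sup>2) * (Suc (N\<^sup>2) * Suc (2 * N\<^sup>2))) div (Suc (N\<^sup>2) * Suc (2 * N\<^sup>2)))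
     (t mod (Suc (N\<^sup>2) * (Suc (N\<^sup>2) * Suc (2 * N\<^sup>2))) mod (Suc (N\<^sup>2) * Suc (2 * N\<^sup>2)) div Suc (2 * N\<^sup>2))
     (t mod (Suc (N\<^sup>2) * (Suc (N\<^sup>2) * Suc (2 * N\<^sup>2))) mod (Suc (N\<^sup>2) * Suc (2 * N\<^sup>2)) mod Suc (2 * N\<^sup>2))"

text \<open>The head of the list is the rotation part, \<open>- y\<close> for \<open>c = 0\<close>
  and \<open>x\<close> for \<open>c = 1\<close>.\<close>

definition coord_code :: "nat \<Rightarrow> nat \<Rightarrow> nat \<Rightarrow> nat \<Rightarrow> nat" where
  "coord_code c S N B = Suc (prod_encode (mono_code (1 - c) 1 1 c (1 - c),
     list_encode (map (\<lambda>t. mono_at c N B t) [0..<S * (Suc (N\<^sup>2) * (Suc (N\<^sup>2) * Suc (2 * N\<^sup>2)))])))"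

lemma poly_coord_code:
  assumes "0 < N" "0 < B"
  shows "poly_of_code (coord_code c S N B) (x, y) =
    (- 1) ^ (1 - c) * x ^ c * y ^ (1 - c) - x ^ (1 - c) * y ^ c * G_approx S N B (x\<^sup>2 + y\<^sup>2)"
proof -
  let ?K3 = "Suc (2 * N\<^sup>2)"
  let ?K2 = "Suc (N\<^sup>2) * ?K3"
  let ?K1 = "Suc (N\<^sup>2) * ?K2"
  let ?m = "\<lambda>s i j p. monomial_of_code (term_code c N B s i j p) (x, y)"
  have "(\<Sum>t<S * ?K1. monomial_of_code (mono_at c N B t) (x, y)) =
    (\<Sum>s<S. \<Sum>r<?K1. ?m s (r div ?K2) (r mod ?K2 div ?K3) (r mod ?K2 mod ?K3))"
    unfolding mono_at_def by (rule sum_div_mod)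
  also have "\<dots> = (\<Sum>s<S. \<Sum>i<Suc (N\<^sup>2). \<Sum>r<?K2. ?m s i (r div ?K3) (r mod ?K3))"
    by (rule sum.cong[OF refl], rule sum_div_mod)
  also have "\<dots> = (\<Sum>s<S. \<Sum>i<Suc (N\<^sup>2). \<Sum>j<Suc (N\<^sup>2). \<Sum>p<?K3. ?m s i j p)"
    by (rule sum.cong[OF refl], rule sum.cong[OF refl], rule sum_div_mod)
  also have "\<dots> = (\<Sum>s<S. \<Sum>i<Suc (N\<^sup>2). - (x ^ (1 - c) * y ^ c) * ((1 / 2) ^ Suc s * (sample N B s i * Bernstein (N\<^sup>2) i ((x\<^sup>2 + y\<^sup>2) / real B))))"
    by (intro sum.cong refl sum_term_code assms) simp
  also have "\<dots> = - (x ^ (1 - c) * y ^ c) * G_approx S N B (x\<^sup>2 + y\<^sup>2)"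
    by (simp only: G_approx_def sum_distrib_left lessThan_Suc_atMost)
  finally have "(\<Sum>t<S * ?K1. monomial_of_code (mono_at c N B t) (x, y)) = - (x ^ (1 - c) * y ^ c) * G_approx S N B (x\<^sup>2 + y\<^sup>2)" .
  moreover have "poly_of_code (coord_code c S N B) (x, y) = monomial_of_code (mono_code (1 - c) 1 1 c (1 - c)) (x, y)
     + (\<Sum>t<S * ?K1. monomial_of_code (mono_at c N B t) (x, y))"
    unfolding poly_of_code_def coord_code_def
    by (simp add: o_def interv_sum_list_conv_sum_set_nat lessThan_atLeast0 del: mult_Suc mult_Suc_right)
  ultimately show ?thesis by (simp add: monomial_mono_code)
qed

text \<open>For \<open>m\<close> coding \<open>(k, l)\<close>, \<open>B = 4 ^ l\<close> bounds the
  squared norm on the ball of radius \<open>2 ^ l\<close>. The truncation error is half and the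
  remaining error \<open>6 / 16\<close> of \<open>1 / 2 ^ (k + l)\<close>; the extra
  \<open>l\<close> pays for the factor \<open>norm z\<close>.\<close>

definition field_code :: "nat \<Rightarrow> nat" where
  "field_code m = prod_encode
     (coord_code 0 (Suc (pfst m + psnd m)) (2 ^ (pfst m + 3 * psnd m + 4)) (4 ^ psnd m),
      coord_code 1 (Suc (pfst m + psnd m)) (2 ^ (pfst m + 3 * psnd m + 4)) (4 ^ psnd m))"

section \<open>Computability of the vector field\<close>

lemma prim_rec_node:
  assumes "prim_rec N" "prim_rec B" "prim_rec S" "prim_rec I"
  shows "prim_rec (\<lambda>e. node (N e) (B e) (S e) (I e))"
  unfolding node_def by (intro prim_recI prim_rec_numer assms)

lemma prim_rec_mono_code:
  assumes "prim_rec A" "prim_rec B" "prim_rec C" "prim_rec D" "prim_rec E"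
  shows "prim_rec (\<lambda>e. mono_code (A e) (B e) (C e) (D e) (E e))"
  unfolding mono_code_def by (intro prim_recI assms)

lemma prim_rec_term_code:
  assumes "prim_rec N" "prim_rec B" "prim_rec S" "prim_rec I" "prim_rec J" "prim_rec P"
  shows "prim_rec (\<lambda>e. term_code c (N e) (B e) (S e) (I e) (J e) (P e))"
  unfolding term_code_def by (intro prim_rec_mono_code prim_recI prim_rec_node assms)

lemma prim_rec_mono_at:
  assumes "prim_rec N" "prim_rec B" "prim_rec T"
  shows "prim_rec (\<lambda>e. mono_at c (N e) (B e) (T e))"
  unfolding mono_at_def by (intro prim_rec_term_code prim_recI assms)

lemma prim_rec_coord_code:
  assumes "prim_rec S" "prim_rec N" "prim_rec B"
  shows "prim_rec (\<lambda>e. coord_code c (S e) (N e) (B e))"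
  by (rule prim_rec_comp3[of "coord_code c", OF _ assms])
    (unfold coord_code_def, intro prim_rec_list_encode_map prim_rec_mono_at prim_recI)

lemma tm_computable_field_code: "tm_computable field_code"
  by (rule tm_computable_prim_rec) (unfold field_code_def, intro prim_rec_coord_code prim_recI)

lemma computable_map_field: "computable_map field"
  unfolding computable_map_def
proof (intro exI conjI allI ballI)
  show "tm_computable field_code" by (rule tm_computable_field_code)
  fix k l and z :: "real \<times> real" assume z: "z \<in> cball 0 (2 ^ l)"
  obtain x y where xy: "z = (x, y)" by fastforce
  define S N B where "S = Suc (k + l)" and "N = (2::nat) ^ (k + 3 * l + 4)" and "B = (4::nat) ^ l"
  let ?u = "x\<^sup>2 + y\<^sup>2"
  have pos: "even N" "0 < N" "0 < B" by (auto simp: N_def B_def)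
  have nz: "norm z \<le> 2 ^ l" using z by simp
  have u: "z \<bullet> z = ?u" by (simp add: xy power2_eq_square)
  have "?u = (norm z)\<^sup>2" by (simp add: xy norm_prod_def)
  also have "\<dots> \<le> (2 ^ l)\<^sup>2" using nz by (intro power_mono) auto
  also have "\<dots> = real B" by (simp add: B_def power2_eq_square power_mult_distrib[symmetric])
  finally have uB: "?u \<le> real B" .
  have "\<bar>G_approx S N B ?u - G ?u\<bar> \<le> (1 / 2) ^ S + 6 * real B / real N"
    using pos uB by (intro G_approx_error) auto
  also have "6 * real B / real N = 6 / 16 * (1 / 2 ^ (k + l))"
    by (simp add: N_def B_def power_add power_mult power_one_over field_simps)
       (simp add: power3_eq_cube power_mult_distrib[symmetric])
  also have "(1 / 2) ^ S + 6 / 16 * (1 / 2 ^ (k + l)) \<le> (1::real) / 2 ^ (k + l)"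
    by (simp add: S_def power_one_over divide_simps)
  finally have err: "\<bar>G_approx S N B ?u - G ?u\<bar> \<le> 1 / 2 ^ (k + l)" .
  have "field_code (prod_encode (k, l)) = prod_encode (coord_code 0 S N B, coord_code 1 S N B)"
    by (simp add: field_code_def S_def N_def B_def)
  then have "poly_map_of_code (field_code (prod_encode (k, l))) z = (- G_approx S N B ?u) *\<^sub>R z + rot z"
    using pos by (simp add: poly_map_of_code_def xy poly_coord_code rot_def mult.commute)
  then have "poly_map_of_code (field_code (prod_encode (k, l))) z - field z = (G ?u - G_approx S N B ?u) *\<^sub>R z"
    by (simp add: field_def u scaleR_left_diff_distrib)
  then have "dist (poly_map_of_code (field_code (prod_encode (k, l))) z) (field z) = \<bar>G_approx S N B ?u - G ?u\<bar> * norm z"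
    by (simp add: dist_norm abs_minus_commute)
  also have "\<dots> \<le> 1 / 2 ^ (k + l) * 2 ^ l"
    using err nz by (intro mult_mono) auto
  finally show "dist (poly_map_of_code (field_code (prod_encode (k, l))) z) (field z) \<le> 1 / 2 ^ k"
    by (simp add: power_add)
qed

lemma computable_point_0: "computable_point 0"
proof -
  have "tm_computable (\<lambda>_. 0)" by (rule tm_computable_prim_rec) (rule prim_rec.zero)
  moreover have "point_of_code 0 = 0"
    by (simp add: point_of_code_def rat_of_code_def prod_decode_def prod_decode_aux.simps
        int_decode_def sum_decode_def zero_prod_def)
  ultimately show ?thesis unfolding computable_point_def by (intro exI[of _ "\<lambda>_. 0"]) simp
qed

theorem theorem4:
  shows "\<exists>h :: real \<times> real \<Rightarrow> real \<times> real.
    computable_map h \<and> C_infinity h \<and> restrict h disk \<in> inward_fields \<and>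
    (\<exists>s. (\<forall>x. equilibrium h x \<longleftrightarrow> x = s) \<and> computable_point s \<and> sink h s \<and>
         \<not> computable_open_set (basin h s)) \<and>
    (\<forall>U. C_neighborhood (restrict h disk) U \<longrightarrow>
      (\<exists>h' :: real \<times> real \<Rightarrow> real \<times> real.
         computable_map h' \<and> C_infinity h' \<and> restrict h' disk \<in> U \<and>
         (\<exists>s'. (\<forall>x. equilibrium h' x \<longleftrightarrow> x = s') \<and> computable_point s' \<and> sink h' s' \<and>
               \<not> computable_open_set (basin h' s'))))"
proof -
  have "restrict field disk \<in> U" if U: "C_neighborhood (restrict field disk) U" for U
  proof -
    obtain e where "0 < e" "{g \<in> inward_fields. C_norm (\<lambda>x. g x - restrict field disk x) < e} \<subseteq> U"
      using U unfolding C_neighborhood_def by blast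
    moreover have "C_norm (\<lambda>x. restrict field disk x - restrict field disk x) = 0"
      by (simp add: C_norm_def max_norm_def)
    ultimately show ?thesis using field_inward by auto
  qed
  moreover have "\<exists>s. (\<forall>x. equilibrium field x \<longleftrightarrow> x = s) \<and> computable_point s \<and> sink field s \<and>
      \<not> computable_open_set (basin field s)"
    using equilibrium_field computable_point_0 sink_field not_computable_disc basin_field by metis
  ultimately show ?thesis
    using computable_map_field C_infinity_field field_inward by metis
qed

end
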